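(* Let $\phi\in\mathcal{S}_d$ be such that $\sup_{\xi\in\mathbb{R}^d}|\hat\phi(\xi)|=1$ and suppose that each $\xi\in\Omega(\phi)$ is of positive homogeneous type for $\hat\phi$. Then there are positive constants $C$ and $C'$ such that $$C'n^{-\mu_\phi}\leq\|\phi^{(n)}\|_{\infty}\leq C n^{-\mu_\phi}$$ for all $n\in\mathbb{N}_+=\{1,2,\dots\}$, where $\|\phi^{(n)}\|_\infty=\sup_{x\in\mathbb{Z}^d}|\phi^{(n)}(x)|$.
   Context: Let $d\ge 1$. For $\phi:\mathbb{Z}^d\to\mathbb{C}$ with $\sum_x|\phi(x)|<\infty$, set $\phi^{(1)}=\phi$ and $\phi^{(n)}=\phi^{(n-1)}*\phi$, where $(\psi*\phi)(x)=\sum_{y\in\mathbb{Z}^d}\psi(x-y)\phi(y)$. $\mathcal{S}_d$ is the set of $\phi:\mathbb{Z}^d\to\mathbb{C}$ such that $\sum_{x}|x^\beta\phi(x)|<\infty$ for all multi-indices $\beta\in\mathbb{N}^d$ (including $\beta=0$). The Fourier transform is $\hat\phi(\xi)=\sum_{x\in\mathbb{Z}^d}\phi(x)e^{ix\cdot\xi}$, $\xi\in\mathbb{R}^d$. Let $\mathbb{T}^d=(-\pi,\pi]^d$. For $E\in M_d(\mathbb{R})$ and $t>0$, $t^E=\exp((\log t)E)$. For a continuous $P:\mathbb{R}^d\to\mathbb{C}$, $\mathrm{Exp}(P)$ is the set of $E\in M_d(\mathbb{R})$ with $tP(\xi)=P(t^E\xi)$ for all $t>0$, $\xi\in\mathbb{R}^d$.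 $P$ is positive homogeneous if $R=\operatorname{Re}P$ is positive definite ($R(\xi)\ge 0$, with $R(\xi)=0$ only when $\xi=0$) and $\mathrm{Exp}(P)$ contains a matrix with real spectrum. For a positive homogeneous polynomial $P$ (complex coefficients, $d$ real variables), $\mu_P:=\operatorname{tr}E$ for any $E\in\mathrm{Exp}(P)$ (this is independent of the choice of $E$). For $\phi\in\mathcal{S}_d$ with $\sup|\hat\phi|=1$, $\Omega(\phi)=\{\xi\in\mathbb{T}^d:|\hat\phi(\xi)|=1\}$. For $\xi_0\in\Omega(\phi)$ put $\Gamma_{\xi_0}(\xi)=\log\big(\hat\phi(\xi+\xi_0)/\hat\phi(\xi_0)\big)$ (principal branch) on a sufficiently small convex open neighborhood $\mathcal{U}$ of $0$. The point $\xi_0$ is of positive homogeneous type for $\hat\phi$ if the Taylor expansion of $\Gamma_{\xi_0}$ about $0$ is of the form $\Gamma_{\xi_0}(\xi)=i\alpha_{\xi_0}\cdot\xi-P_{\xi_0}(\xi)+\Upsilon_{\xi_0}(\xi)$, where $\alpha_{\xi_0}\in\mathbb{R}^d$ (the drift), $P_{\xi_0}$ is a positive homogeneous polynomial, and $\Upsilon_{\xi_0}(\xi)=o(\operatorname{Re}P_{\xi_0}(\xi))$ as $\xi\to 0$; then $\alpha_{\xi_0}$ and $P_{\xi_0}$ are unique. If every point of $\Omega(\phi)$ is of positive homogeneous type, then $\Omega(\phi)$ is finite and $\mu_\phi:=\min_{\xi\in\Omega(\phi)}\mu_{P_\xi}$. *)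

theory Defs
  imports "HOL-Analysis.Analysis" "HOL-Library.Landau_Symbols"
begin

text \<open>
  The dimension $d \geq 1$ is \<open>CARD('d)\<close> for an index type \<open>'d\<close> of class \<open>finite\<close>:
  the lattice is \<open>int ^ 'd\<close>, its dual space is \<open>real ^ 'd\<close>, multi-indices are \<open>nat ^ 'd\<close>.
\<close>

definition real_vec :: "int ^ 'd \<Rightarrow> real ^ 'd" where
  "real_vec x = (\<chi> i. real_of_int (x $ i))"

definition lattice_monom :: "nat ^ 'd \<Rightarrow> int ^ 'd \<Rightarrow> int" where
  "lattice_monom \<beta> x = (\<Prod>i\<in>UNIV. (x $ i) ^ (\<beta> $ i))"

definition S_space :: "(int ^ 'd \<Rightarrow> complex) set" where
  "S_space = {\<phi>. \<forall>\<beta> :: nat ^ 'd.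
     (\<lambda>x. norm (of_int (lattice_monom \<beta> x) * \<phi> x)) summable_on UNIV}"

definition convolution ::
    "(int ^ 'd \<Rightarrow> complex) \<Rightarrow> (int ^ 'd \<Rightarrow> complex) \<Rightarrow> int ^ 'd \<Rightarrow> complex" where
  "convolution \<psi> \<phi> x = (\<Sum>\<^sub>\<infinity>y. \<psi> (x - y) * \<phi> y)"

text \<open>
  Convolution powers are only meant for exponents $n \geq 1$; the value at \<open>0\<close> (the unit mass
  at the origin) is a convention that makes the function total.
\<close>

fun conv_power :: "(int ^ 'd \<Rightarrow> complex) \<Rightarrow> nat \<Rightarrow> int ^ 'd \<Rightarrow> complex" where
  "conv_power \<phi> 0 = (\<lambda>x. if x = 0 then 1 else 0)"
| "conv_power \<phi> (Suc 0) = \<phi>"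
| "conv_power \<phi> (Suc (Suc n)) = convolution (conv_power \<phi> (Suc n)) \<phi>"

definition sup_norm :: "(int ^ 'd \<Rightarrow> complex) \<Rightarrow> real" where
  "sup_norm \<phi> = (SUP x. norm (\<phi> x))"

definition fourier :: "(int ^ 'd \<Rightarrow> complex) \<Rightarrow> real ^ 'd \<Rightarrow> complex" where
  "fourier \<phi> \<xi> = (\<Sum>\<^sub>\<infinity>x. \<phi> x * exp (\<i> * complex_of_real (real_vec x \<bullet> \<xi>)))"

definition torus :: "(real ^ 'd) set" where
  "torus = {\<xi>. \<forall>i. - pi < \<xi> $ i \<and> \<xi> $ i \<le> pi}"

definition Omega :: "(int ^ 'd \<Rightarrow> complex) \<Rightarrow> (real ^ 'd) set" where
  "Omega \<phi> = {\<xi> \<in> torus. norm (fourier \<phi> \<xi>) = 1}"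

text \<open>
  The ring multiplication (hence also \<open>^\<close>) that the library puts on \<open>real ^ 'd ^ 'd\<close> is
  componentwise, so powers and the exponential of a matrix are built from the matrix product \<open>**\<close>.
\<close>

primrec matrix_power :: "real ^ 'd ^ 'd \<Rightarrow> nat \<Rightarrow> real ^ 'd ^ 'd" where
  "matrix_power A 0 = mat 1"
| "matrix_power A (Suc k) = A ** matrix_power A k"

definition matrix_exp :: "real ^ 'd ^ 'd \<Rightarrow> real ^ 'd ^ 'd" where
  "matrix_exp A = (\<Sum>k. matrix_power A k /\<^sub>R fact k)"

definition real_powm :: "real \<Rightarrow> real ^ 'd ^ 'd \<Rightarrow> real ^ 'd ^ 'd" where
  "real_powm t E = matrix_exp (ln t *\<^sub>R E)"

definition complex_spectrum :: "real ^ 'd ^ 'd \<Rightarrow> complex set" where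
  "complex_spectrum E = {z. \<not> invertible (mat z - (\<chi> i j. complex_of_real (E $ i $ j)))}"

definition Exp_set :: "(real ^ 'd \<Rightarrow> complex) \<Rightarrow> (real ^ 'd ^ 'd) set" where
  "Exp_set P = {E. \<forall>t>0. \<forall>\<xi>. complex_of_real t * P \<xi> = P (real_powm t E *v \<xi>)}"

definition positive_homogeneous :: "(real ^ 'd \<Rightarrow> complex) \<Rightarrow> bool" where
  "positive_homogeneous P \<longleftrightarrow>
     continuous_on UNIV P \<and>
     (\<forall>\<xi>. 0 \<le> Re (P \<xi>)) \<and> (\<forall>\<xi>. Re (P \<xi>) = 0 \<longrightarrow> \<xi> = 0) \<and>
     (\<exists>E \<in> Exp_set P. complex_spectrum E \<subseteq> \<real>)"

text \<open>
  For complex-valued functions \<^const>\<open>polynomial_function\<close> says that \<open>Re \<circ> P\<close> and \<open>Im \<circ> P\<close> are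
  real polynomials in the coordinates, i.e. that \<open>P\<close> is a polynomial with complex coefficients.
\<close>

definition pos_hom_polynomial :: "(real ^ 'd \<Rightarrow> complex) \<Rightarrow> bool" where
  "pos_hom_polynomial P \<longleftrightarrow> polynomial_function P \<and> positive_homogeneous P"

text \<open>The trace is the same for all elements of \<open>Exp_set P\<close>, so the choice is immaterial.\<close>

definition mu_poly :: "(real ^ 'd \<Rightarrow> complex) \<Rightarrow> real" where
  "mu_poly P = trace (SOME E. E \<in> Exp_set P)"

text \<open>
  \<^const>\<open>Ln\<close> is the principal branch, extended by convention outside its natural domain. Only the
  germ at $0$ of \<open>log_ratio\<close> is used, where the argument of \<^const>\<open>Ln\<close> is close to $1$.
\<close>

definition log_ratio :: "(int ^ 'd \<Rightarrow> complex) \<Rightarrow> real ^ 'd \<Rightarrow> real ^ 'd \<Rightarrow> complex" where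
  "log_ratio \<phi> \<xi>\<^sub>0 \<xi> = Ln (fourier \<phi> (\<xi> + \<xi>\<^sub>0) / fourier \<phi> \<xi>\<^sub>0)"

text \<open>
  The remainder \<open>\<Upsilon>\<close> is determined by the drift \<open>\<alpha>\<close> and the polynomial \<open>P\<close>, hence
  it is written out instead of being quantified.
\<close>

definition has_pos_hom_expansion ::
    "(int ^ 'd \<Rightarrow> complex) \<Rightarrow> real ^ 'd \<Rightarrow> real ^ 'd \<Rightarrow> (real ^ 'd \<Rightarrow> complex) \<Rightarrow> bool" where
  "has_pos_hom_expansion \<phi> \<xi>\<^sub>0 \<alpha> P \<longleftrightarrow>
     pos_hom_polynomial P \<and>
     (\<lambda>\<xi>. log_ratio \<phi> \<xi>\<^sub>0 \<xi> - (\<i> * complex_of_real (\<alpha> \<bullet> \<xi>) - P \<xi>))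
       \<in> o[at 0](\<lambda>\<xi>. complex_of_real (Re (P \<xi>)))"

definition pos_hom_type :: "(int ^ 'd \<Rightarrow> complex) \<Rightarrow> real ^ 'd \<Rightarrow> bool" where
  "pos_hom_type \<phi> \<xi>\<^sub>0 \<longleftrightarrow> (\<exists>\<alpha> P. has_pos_hom_expansion \<phi> \<xi>\<^sub>0 \<alpha> P)"

text \<open>
  For \<open>\<phi>\<close> in \<open>S_space\<close> the pair \<open>(\<alpha>, P)\<close> is unique, so the choice is immaterial.
\<close>

definition pos_hom_part :: "(int ^ 'd \<Rightarrow> complex) \<Rightarrow> real ^ 'd \<Rightarrow> real ^ 'd \<Rightarrow> complex" where
  "pos_hom_part \<phi> \<xi>\<^sub>0 = (SOME P. \<exists>\<alpha>. has_pos_hom_expansion \<phi> \<xi>\<^sub>0 \<alpha> P)"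

definition mu :: "(int ^ 'd \<Rightarrow> complex) \<Rightarrow> real" where
  "mu \<phi> = Min ((\<lambda>\<xi>. mu_poly (pos_hom_part \<phi> \<xi>)) ` Omega \<phi>)"

end

theory Submission
  imports Defs "HOL-Real_Asymp.Real_Asymp"
begin

text \<open>
  Write \<open>F\<close> for the Fourier transform of \<open>\<phi>\<close>. By Fourier inversion over the cube \<open>[-\<pi>, \<pi>]\<^sup>d\<close>,
  the \<open>n\<close>-th convolution power is bounded by the integral of \<open>|F|\<^sup>n\<close>, and only small neighbourhoods of
  the points where \<open>|F| = 1\<close> contribute more than an exponentially small amount. Near such a point \<open>z\<close>
  the expansion gives \<open>|F(z + \<xi>)| \<le> exp(- R(\<xi>) / 2)\<close> with \<open>R = Re P\<close>. Since \<open>R(t\<^sup>E \<xi>) = t R(\<xi>)\<close> and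
  \<open>t\<^sup>E\<close> scales volume by \<open>det(t\<^sup>E) = t\<close> to the power \<open>tr E\<close>, the integral of \<open>exp(- n R / 2)\<close> is a constant
  times \<open>n\<close> to the power \<open>- tr E\<close>. A finite cover of the compact cube then leaves the smallest
  exponent, which is the upper bound (\<open>nn_integral_exp_le\<close>, \<open>local_upper_bound\<close>, \<open>nn_integral_power_le\<close>).

  What makes this work is that a positive definite homogeneous \<open>R\<close> has bounded sublevel sets
  (\<open>sublevel_subset_ball\<close>): along an orbit \<open>t\<^sup>E \<xi>\<close> the value of \<open>R\<close>
  is proportional to \<open>t\<close>, so once it is below the minimum of \<open>R\<close> on a sphere, the orbit cannot cross
  that sphere as \<open>t\<close> decreases.

  The lower bound comes from pairing the convolution power with a test function. At a maximum \<open>z\<close> of least exponent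
  take the small set \<open>A = n\<^sup>-\<^sup>E B\<close> for a small ball \<open>B\<close>, and let \<open>S(x)\<close> be the integral over \<open>A\<close> of the
  character \<open>exp(i x \<bullet> \<eta>)\<close> times the phase \<open>exp(- i n \<alpha> \<bullet> \<eta>)\<close> that undoes the drift. The sum of
  \<open>\<phi>\<^sup>(\<^sup>n\<^sup>)(x) exp(i x \<bullet> z) |S(x)|\<^sup>2\<close> over the lattice equals a double integral over \<open>A \<times> A\<close> of
  \<open>F(z + \<eta> - \<eta>')\<^sup>n\<close> times phases. For \<open>\<eta>\<close>, \<open>\<eta>'\<close> in \<open>A\<close> this integrand is close to the constant \<open>F(z)\<^sup>n\<close>, so the
  double integral has modulus at least \<open>|A|\<^sup>2 / 2\<close>. On the other hand Bessel's inequality bounds the sum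
  by the sup norm times \<open>(2\<pi>)\<^sup>d |A|\<close>. Hence the sup norm is at least a constant times \<open>|A|\<close>, that is,
  a constant times \<open>n\<close> to the power \<open>- tr E\<close> (\<open>sup_norm_lower_bound\<close>, \<open>lower_bound_at_maximum\<close>).
\<close>

section \<open>Matrix exponentials and the one-parameter groups they generate\<close>

lemma matrix_mult_bilinear: "bounded_bilinear ((**) :: real^'d^'d \<Rightarrow> real^'d^'d \<Rightarrow> real^'d^'d)"
proof -
  have "bilinear ((**) :: real^'d^'d \<Rightarrow> real^'d^'d \<Rightarrow> real^'d^'d)"
    unfolding bilinear_def
    by (intro conjI allI linearI)
       (auto simp: vec_eq_iff matrix_matrix_mult_def
          sum.distrib sum_distrib_left algebra_simps)
  then show ?thesis
    by (simp add: bilinear_conv_bounded_bilinear)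
qed

lemma matrix_power_scaleR: "matrix_power (s *\<^sub>R A) k = s ^ k *\<^sub>R matrix_power A k"
  by (induction k) (auto simp: vec_eq_iff matrix_matrix_mult_def sum_distrib_left algebra_simps)

lemma matrix_power_commute: "matrix_power A k ** A = A ** matrix_power A k"
  by (induction k) (auto simp flip: matrix_mul_assoc)

lemma summable_matrix_exp: "summable (\<lambda>k. matrix_power A k /\<^sub>R fact k)" for A :: "real^'d^'d"
proof -
  have "\<exists>K>0. \<forall>(B :: real^'d^'d) (C :: real^'d^'d). norm (B ** C) \<le> norm B * norm C * K"
    by (rule bounded_bilinear.pos_bounded[OF matrix_mult_bilinear])
  then obtain K where K: "\<And>(B :: real^'d^'d) (C :: real^'d^'d). norm (B ** C) \<le> norm B * norm C * K" "0 < K"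
    by blast
  have bd: "norm (matrix_power A k) \<le> norm (mat 1 :: real^'d^'d) * (norm A * K) ^ k" for k
  proof (induction k)
    case (Suc k)
    have "norm (matrix_power A (Suc k)) \<le> norm A * norm (matrix_power A k) * K"
      using K(1) by simp
    also have "\<dots> \<le> norm A * (norm (mat 1 :: real^'d^'d) * (norm A * K) ^ k) * K"
      using K(2) Suc by (intro mult_right_mono mult_left_mono) auto
    finally show ?case by (simp add: algebra_simps)
  qed simp
  show ?thesis
  proof (rule summable_norm_cancel, rule summable_comparison_test)
    show "summable (\<lambda>k. norm (mat 1 :: real^'d^'d) * ((norm A * K) ^ k /\<^sub>R fact k))"
      by (intro summable_mult summable_exp_generic)
    show "\<exists>N. \<forall>k\<ge>N. norm (norm (matrix_power A k /\<^sub>R fact k))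
        \<le> norm (mat 1 :: real^'d^'d) * ((norm A * K) ^ k /\<^sub>R fact k)"
      using bd by (auto simp: divide_simps)
  qed
qed

lemma matrix_exp_entry:
  "(\<lambda>k. (matrix_power A k $ i $ j / fact k) * s ^ k) sums (matrix_exp (s *\<^sub>R A) $ i $ j)"
proof -
  have "(\<lambda>k. matrix_power (s *\<^sub>R A) k /\<^sub>R fact k) sums matrix_exp (s *\<^sub>R A)"
    unfolding matrix_exp_def by (rule summable_sums[OF summable_matrix_exp])
  then have "(\<lambda>k. (matrix_power (s *\<^sub>R A) k /\<^sub>R fact k) $ i $ j) sums (matrix_exp (s *\<^sub>R A) $ i $ j)"
    by (intro sums_vec_nth)
  then show ?thesis
    by (simp add: matrix_power_scaleR divide_simps mult.commute)
qed

lemma matrix_exp_entry_deriv: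
  "((\<lambda>s. matrix_exp (s *\<^sub>R A) $ i $ j) has_real_derivative (A ** matrix_exp (s *\<^sub>R A)) $ i $ j) (at s)"
proof -
  let ?c = "\<lambda>l k. matrix_power A k $ l $ j / fact k"
  have sums: "(\<lambda>k. ?c l k * s ^ k) sums (matrix_exp (s *\<^sub>R A) $ l $ j)" for l s
    by (rule matrix_exp_entry)
  have eq: "(\<lambda>s. matrix_exp (s *\<^sub>R A) $ i $ j) = (\<lambda>s. \<Sum>k. ?c i k * s ^ k)"
    using sums sums_unique by blast
  have "diffs (?c i) k = (\<Sum>l\<in>UNIV. A $ i $ l * ?c l k)" for k
  proof -
    have "diffs (?c i) k = (A ** matrix_power A k) $ i $ j / fact k"
      by (simp add: diffs_def divide_simps)
    then show ?thesis
      by (simp add: matrix_matrix_mult_def sum_divide_distrib)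
  qed
  then have "(\<lambda>k. diffs (?c i) k * s ^ k) = (\<lambda>k. \<Sum>l\<in>UNIV. A $ i $ l * (?c l k * s ^ k))"
    by (simp add: sum_distrib_right mult.assoc)
  moreover have "(\<lambda>k. \<Sum>l\<in>UNIV. A $ i $ l * (?c l k * s ^ k)) sums
      (\<Sum>l\<in>UNIV. A $ i $ l * matrix_exp (s *\<^sub>R A) $ l $ j)"
    by (intro sums_sum sums_mult sums)
  ultimately have "(\<Sum>k. diffs (?c i) k * s ^ k) = (A ** matrix_exp (s *\<^sub>R A)) $ i $ j"
    by (simp add: sums_unique[symmetric] matrix_matrix_mult_def)
  moreover have "((\<lambda>s. \<Sum>k. ?c i k * s ^ k) has_real_derivative (\<Sum>k. diffs (?c i) k * s ^ k)) (at s)"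
    by (rule termdiffs_strong_converges_everywhere) (rule sums_summable[OF sums])
  ultimately show ?thesis unfolding eq by simp
qed

lemma has_vector_derivative_matrixI:
  fixes F :: "real \<Rightarrow> real^'d^'d"
  assumes "\<And>i j. ((\<lambda>s. F s $ i $ j) has_real_derivative F' $ i $ j) (at s)"
  shows "(F has_vector_derivative F') (at s)"
  unfolding has_vector_derivative_def
proof (subst has_derivative_componentwise_within, safe)
  fix b :: "real^'d^'d" assume "b \<in> Basis"
  then obtain i j where b: "b = axis i (axis j 1)"
    by (auto simp: Basis_vec_def)
  show "((\<lambda>s. F s \<bullet> b) has_derivative (\<lambda>y. (y *\<^sub>R F') \<bullet> b)) (at s)"
    using assms[of i j]
    by (simp add: b inner_axis inner_axis' has_field_derivative_def mult_commute_abs)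
qed

text \<open>
  The exponential solves a linear differential equation; the functional equation and the determinant
  formula below are both read off from it.
\<close>

lemma matrix_exp_deriv:
  "((\<lambda>s. matrix_exp (s *\<^sub>R A)) has_vector_derivative A ** matrix_exp (s *\<^sub>R A)) (at s)"
  by (intro has_vector_derivative_matrixI matrix_exp_entry_deriv)

lemma matrix_exp_zero: "matrix_exp 0 = (mat 1 :: real^'d^'d)"
proof -
  have "matrix_exp (0 *\<^sub>R (0::real^'d^'d)) $ i $ j = (mat 1 :: real^'d^'d) $ i $ j" for i j
  proof -
    have "(\<lambda>k. (matrix_power (0::real^'d^'d) k $ i $ j / fact k) * 0 ^ k) sums
       (matrix_power (0::real^'d^'d) 0 $ i $ j / fact 0)"
      using powser_sums_zero[of "\<lambda>k. matrix_power (0::real^'d^'d) k $ i $ j / fact k"] by simp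
    from sums_unique2[OF matrix_exp_entry this] show ?thesis by simp
  qed
  then show ?thesis by (simp add: vec_eq_iff)
qed

lemma matrix_exp_commute: "matrix_exp A ** A = A ** matrix_exp A" for A :: "real^'d^'d"
proof -
  interpret bounded_bilinear "(**) :: real^'d^'d \<Rightarrow> real^'d^'d \<Rightarrow> real^'d^'d"
    by (rule matrix_mult_bilinear)
  have s: "(\<lambda>k. matrix_power A k /\<^sub>R fact k) sums matrix_exp A"
    unfolding matrix_exp_def by (rule summable_sums[OF summable_matrix_exp])
  have "(\<lambda>k. (matrix_power A k /\<^sub>R fact k) ** A) sums (matrix_exp A ** A)"
    "(\<lambda>k. A ** (matrix_power A k /\<^sub>R fact k)) sums (A ** matrix_exp A)"
    using bounded_linear.sums[OF bounded_linear_left s] bounded_linear.sums[OF bounded_linear_right s]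
    by auto
  then show ?thesis
    by (simp add: scaleR_left scaleR_right matrix_power_commute sums_unique2)
qed

text \<open>
  The product \<open>exp((r + s - u) A) exp(u A)\<close> has derivative \<open>0\<close> in \<open>u\<close>, because the two exponentials
  commute with \<open>A\<close>; compare \<open>u = 0\<close> with \<open>u = s\<close>.
\<close>

lemma matrix_exp_add_scaled:
  "matrix_exp ((r + s) *\<^sub>R A) = matrix_exp (r *\<^sub>R A) ** matrix_exp (s *\<^sub>R A)" for A :: "real^'d^'d"
proof -
  let ?M = "\<lambda>s. matrix_exp (s *\<^sub>R A)"
  let ?G = "\<lambda>u. ?M (r + s - u) ** ?M u"
  have comm: "?M u ** A = A ** ?M u" for u
  proof (cases "u = 0")
    case False
    have "u *\<^sub>R (?M u ** A) = u *\<^sub>R (A ** ?M u)"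
      using matrix_exp_commute[of "u *\<^sub>R A"]
      by (simp add: bounded_bilinear.scaleR_left[OF matrix_mult_bilinear]
          bounded_bilinear.scaleR_right[OF matrix_mult_bilinear])
    with False show ?thesis by simp
  qed (simp add: matrix_exp_zero)
  have "(?G has_vector_derivative 0) (at u)" for u
  proof -
    have 1: "((\<lambda>u. ?M (r + s - u)) has_vector_derivative - (A ** ?M (r + s - u))) (at u)"
    proof -
      have "((\<lambda>u. r + s - u) has_vector_derivative -1) (at u)"
        by (auto intro!: derivative_eq_intros)
      from vector_diff_chain_at[OF this matrix_exp_deriv] show ?thesis
        by (simp add: o_def)
    qed
    have "(?G has_vector_derivative ?M (r + s - u) ** (A ** ?M u) + - (A ** ?M (r + s - u)) ** ?M u) (at u)"
      using bounded_bilinear.has_vector_derivative[OF matrix_mult_bilinear 1 matrix_exp_deriv] .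
    moreover have "?M (r + s - u) ** (A ** ?M u) + - (A ** ?M (r + s - u)) ** ?M u = 0"
      by (simp add: bounded_bilinear.minus_left[OF matrix_mult_bilinear] matrix_mul_assoc comm)
    ultimately show ?thesis by simp
  qed
  then have "?G 0 = ?G s"
    by (intro has_derivative_zero_unique[of UNIV]) (auto simp: has_vector_derivative_def)
  then show ?thesis by (simp add: matrix_exp_zero)
qed

text \<open>
  In the Leibniz expansion every permutation other than the identity moves at least two points, so
  after differentiating one factor an off-diagonal entry of the identity matrix is still present.
\<close>

lemma det_derivative_at_one:
  fixes F :: "real \<Rightarrow> real^'d^'d"
  assumes F: "\<And>i j. ((\<lambda>s. F s $ i $ j) has_real_derivative E $ i $ j) (at 0)" and F0: "F 0 = mat 1"
  shows "((\<lambda>s. det (F s)) has_real_derivative trace E) (at 0)"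
proof -
  let ?P = "{p. p permutes (UNIV::'d set)}"
  let ?D = "\<lambda>p. of_int (sign p) * (\<Sum>i\<in>UNIV. E $ i $ p i * (\<Prod>j\<in>UNIV-{i}. F 0 $ j $ p j))"
  have "((\<lambda>s. det (F s)) has_real_derivative (\<Sum>p\<in>?P. ?D p)) (at 0)"
    unfolding det_def has_field_derivative_def
    apply (rule has_derivative_eq_rhs)
     apply (rule has_derivative_sum has_derivative_mult_right has_derivative_prod
        F[unfolded has_field_derivative_def])+
    by (auto simp: fun_eq_iff sum_distrib_left sum_distrib_right algebra_simps)
  moreover have "?D p = 0" if p: "p permutes UNIV" "p \<noteq> id" for p
  proof -
    have "(\<Prod>j\<in>UNIV-{i}. F 0 $ j $ p j) = 0" for i
    proof -
      have "\<exists>j. j \<noteq> i \<and> p j \<noteq> j"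
      proof (rule ccontr)
        assume "\<not> ?thesis"
        then have *: "p j = j" if "j \<noteq> i" for j using that by auto
        have "p i = i"
          using * permutes_inj[OF p(1)] by (metis injD)
        with * p(2) show False by (auto simp: fun_eq_iff) metis
      qed
      then obtain j where "j \<noteq> i" "p j \<noteq> j" by blast
      then show ?thesis by (intro prod_zero) (auto simp: F0 mat_def intro!: bexI[of _ j])
    qed
    then show ?thesis by (simp only: mult_zero_right sum.neutral_const)
  qed
  then have "(\<Sum>p\<in>?P. ?D p) = (\<Sum>p\<in>{id}. ?D p)"
    by (intro sum.mono_neutral_right) (auto simp: permutes_id)
  moreover have "?D id = trace E"
    by (simp add: F0 mat_def trace_def)
  ultimately show ?thesis by simp
qed

text \<open>
  By the functional equation and \<open>det_derivative_at_one\<close>, \<open>det (exp (s A))\<close> solves the scalar equation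
  \<open>y' = tr A \<cdot> y\<close> with \<open>y(0) = 1\<close>.
\<close>

lemma det_matrix_exp: "det (matrix_exp (s *\<^sub>R A)) = exp (s * trace A)" for A :: "real^'d^'d"
proof -
  let ?M = "\<lambda>s. matrix_exp (s *\<^sub>R A)"
  have d0: "((\<lambda>s. det (?M s)) has_real_derivative trace A) (at 0)"
    using matrix_exp_entry_deriv[of A _ _ 0]
    by (intro det_derivative_at_one) (auto simp: matrix_exp_zero)
  have d: "((\<lambda>s. det (?M s)) has_real_derivative det (?M u) * trace A) (at u)" for u
  proof -
    have "((\<lambda>s. det (?M u) * det (?M (s - u))) has_real_derivative det (?M u) * trace A) (at u)"
      using DERIV_shift[of "\<lambda>s. det (?M s)" "trace A" u "-u"] d0
      by (intro DERIV_cmult) auto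
    moreover have "det (?M u) * det (?M (s - u)) = det (?M s)" for s
      using matrix_exp_add_scaled[of u "s - u" A] by (simp add: det_mul)
    ultimately show ?thesis by simp
  qed
  have "((\<lambda>s. det (?M s) * exp (- s * trace A)) has_real_derivative 0) (at u)" for u
    by (rule derivative_eq_intros d refl | simp)+
  then have "det (?M s) * exp (- s * trace A) = det (?M 0) * exp (- 0 * trace A)"
    by (intro DERIV_const_ratio_const2 DERIV_isconst_all) auto
  then show ?thesis by (simp add: matrix_exp_zero exp_minus field_simps)
qed

lemma real_powm_one [simp]: "real_powm 1 E = mat 1"
  by (simp add: real_powm_def matrix_exp_zero)

lemma real_powm_mult:
  "0 < s \<Longrightarrow> 0 < t \<Longrightarrow> real_powm (s * t) E = real_powm s E ** real_powm t E"
  by (simp add: real_powm_def ln_mult matrix_exp_add_scaled)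

lemma det_real_powm: "0 < t \<Longrightarrow> det (real_powm t E) = t powr trace E"
  by (simp add: real_powm_def det_matrix_exp powr_def mult.commute)

lemma continuous_on_real_powm: "continuous_on {0<..} (\<lambda>t. real_powm t E *v \<xi>)"
proof -
  have "continuous_on UNIV (\<lambda>s. matrix_exp (s *\<^sub>R E))"
    using matrix_exp_deriv has_vector_derivative_continuous
    by (force simp: continuous_on_eq_continuous_at)
  then have "continuous_on {0<..} (\<lambda>t. real_powm t E)"
    unfolding real_powm_def
    by (rule continuous_on_compose2[where f = ln]) (auto intro!: continuous_intros)
  then show ?thesis
    by (auto simp: matrix_vector_mult_def intro!: continuous_intros)
qed

lemma real_powm_inverse:
  assumes "0 < t"
  shows "real_powm t E *v (real_powm (1 / t) E *v \<xi>) = \<xi>"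
    "real_powm (1 / t) E *v (real_powm t E *v \<xi>) = \<xi>"
  using assms real_powm_mult[of t "1 / t" E] real_powm_mult[of "1 / t" t E]
  by (simp_all add: matrix_vector_mul_assoc flip: real_powm_mult)

section \<open>Linear images of measurable sets\<close>

lemma lmeasurable_image_if_box_preserving:
  fixes A :: "real^'d^'d"
  assumes "\<bar>det A\<bar> = 1"
    and "\<And>a b. measure lebesgue ((*v) A ` cbox a b) = measure lebesgue (cbox a b)"
  shows "\<forall>S \<in> lmeasurable. (*v) A ` S \<in> lmeasurable \<and>
    measure lebesgue ((*v) A ` S) = \<bar>det A\<bar> * measure lebesgue S"
proof
  fix S :: "(real^'d) set" assume "S \<in> lmeasurable"
  from measure_linear_sufficient[OF matrix_vector_mul_linear this, of A 1] assms(2)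
  have "(*v) A ` S \<in> lmeasurable \<and> 1 * measure lebesgue S = measure lebesgue ((*v) A ` S)"
    by (simp only: mult_1)
  then show "(*v) A ` S \<in> lmeasurable \<and>
      measure lebesgue ((*v) A ` S) = \<bar>det A\<bar> * measure lebesgue S"
    by (simp only: assms(1))
qed

text \<open>
  The volume factor of \<open>A\<close> and \<open>|det A|\<close> are both multiplicative, so it suffices to check elementary matrices. The index type
  carries no order, whence the determinant of a shear is computed by a row operation rather than
  read off from a triangular shape.
\<close>

lemma lmeasurable_matrix_image:
  fixes A :: "real^'d^'d"
  shows "\<forall>S \<in> lmeasurable. (*v) A ` S \<in> lmeasurable \<and>
    measure lebesgue ((*v) A ` S) = \<bar>det A\<bar> * measure lebesgue S"
proof (induction A rule: induct_matrix_elementary_alt)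
  case (1 A B)
  have "(*v) (A ** B) ` S = (*v) A ` (*v) B ` S" for S
    by (auto simp: image_image matrix_vector_mul_assoc)
  with 1 show ?case
    by (simp only: det_mul abs_mult mult.assoc) metis
next
  case (2 A i)
  have "det A = 0"
    using 2 by (simp add: det_zero_row)
  then have "\<not> inj ((*v) A)"
    using det_nz_iff_inj[of "(*v) A"] by simp
  then have "negligible ((*v) A ` S)" for S
    by (intro negligible_linear_singular_image) auto
  with \<open>det A = 0\<close> show ?case
    by (simp add: negligible_iff_measure)
next
  case (3 A)
  have "(*v) A = (\<lambda>x. \<chi> k. A $ k $ k * x $ k)"
  proof (intro ext, simp add: matrix_vector_mult_def vec_eq_iff, intro allI)
    fix x :: "real^'d" and k
    have "(\<Sum>j\<in>UNIV. A $ k $ j * x $ j) = (\<Sum>j\<in>{k}. A $ k $ j * x $ j)"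
      using 3 by (intro sum.mono_neutral_right) auto
    then show "(\<Sum>j\<in>UNIV. A $ k $ j * x $ j) = A $ k $ k * x $ k" by simp
  qed
  then show ?case
    using 3 measurable_stretch[where m = "\<lambda>k. A $ k $ k"] measure_stretch[where m = "\<lambda>k. A $ k $ k"]
    by (simp add: det_diagonal)
next
  case (4 m n)
  let ?p = "Transposition.transpose m n"
  define B :: "real^'d^'d" where "B = (\<chi> i j. mat 1 $ i $ ?p j)"
  have p: "?p permutes UNIV" by (simp add: permutes_swap_id)
  have nth: "(B *v x) $ i = x $ ?p i" for x i
  proof -
    have "(B *v x) $ i = (\<Sum>j\<in>UNIV. (if i = ?p j then 1 else 0) * x $ j)"
      by (simp add: matrix_vector_mult_def mat_def B_def)
    also have "\<dots> = (\<Sum>j\<in>UNIV. if j = ?p i then x $ j else 0)"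
      by (intro sum.cong refl) (metis (full_types) mult_1 mult_zero_left transpose_involutory)
    finally show ?thesis by simp
  qed
  have det: "\<bar>det B\<bar> = 1"
    using det_permute_columns[OF p, of "mat 1 :: real^'d^'d"] by (simp add: B_def sign_swap_id 4 abs_mult)
  have "measure lebesgue ((*v) B ` cbox a b) = measure lebesgue (cbox a b)" for a b
  proof (cases "cbox a b = {}")
    case False
    have "(*v) B ` cbox a b = cbox (B *v a) (B *v b)"
    proof (intro set_eqI iffI)
      fix y assume y: "y \<in> cbox (B *v a) (B *v b)"
      have "y = B *v (B *v y)" by (simp add: vec_eq_iff nth)
      moreover have "B *v y \<in> cbox a b"
        unfolding mem_box_cart
      proof
        fix i
        have "a $ ?p (?p i) \<le> y $ ?p i \<and> y $ ?p i \<le> b $ ?p (?p i)"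
          using y unfolding mem_box_cart nth by blast
        then show "a $ i \<le> (B *v y) $ i \<and> (B *v y) $ i \<le> b $ i"
          by (simp add: nth)
      qed
      ultimately show "y \<in> (*v) B ` cbox a b" by blast
    qed (auto simp: mem_box_cart nth)
    moreover have "cbox (B *v a) (B *v b) \<noteq> {}" using False calculation by blast
    ultimately have "measure lborel (cbox (B *v a) (B *v b)) = measure lborel (cbox a b)"
      using content_cbox_cart[OF False] content_cbox_cart[of "B *v a" "B *v b"]
        prod.permute[OF p, of "\<lambda>i. b $ i - a $ i"]
      by (simp only: nth o_def not_False_eq_True simp_thms)
    then show ?thesis
      by (simp add: \<open>(*v) B ` cbox a b = _\<close>)
  qed simp
  from lmeasurable_image_if_box_preserving[OF det this] show ?case
    unfolding B_def .
next
  case (5 m n)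
  let ?B = "(\<chi> i j. of_bool (i = m \<and> j = n \<or> i = j)) :: real^'d^'d"
  have B: "(*v) ?B = (\<lambda>x. \<chi> i. if i = m then x $ m + x $ n else x $ i)"
  proof (intro ext, subst vec_eq_iff, intro allI)
    fix x :: "real^'d" and i
    have "(?B *v x) $ i = (\<Sum>j\<in>UNIV. (if j = i then x $ j else 0) + (if i = m \<and> j = n then x $ j else 0))"
      using 5 by (auto simp: matrix_vector_mult_def intro!: sum.cong)
    then show "(?B *v x) $ i = (\<chi> i. if i = m then x $ m + x $ n else x $ i) $ i"
      by (simp add: sum.distrib)
  qed
  have "?B = (\<chi> k. if k = m then row m (mat 1) + 1 *s row n (mat 1) else row k (mat 1))"
    using 5 by (auto simp: vec_eq_iff row_def mat_def)
  then have det: "det ?B = 1"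
    using det_row_operation[OF 5, of "mat 1 :: real^'d^'d" 1] by simp
  have shear: "measure lebesgue ((*v) ?B ` cbox a b) = measure lebesgue (cbox a b)"
    if "cbox a b \<noteq> {}" "0 \<le> a $ n" for a b
    unfolding B using measure_shear_interval[OF 5 that] .
  have "measure lebesgue ((*v) ?B ` cbox a b) = measure lebesgue (cbox a b)" for a b
  proof (cases "cbox a b = {}")
    case False
    \<comment> \<open>Translate the box so that its \<open>n\<close>-th coordinates are nonnegative.\<close>
    define v :: "real^'d" where "v = axis n (- min 0 (a $ n))"
    have v: "0 \<le> (v + a) $ n" by (simp add: v_def)
    have "(*v) ?B ` cbox (v + a) (v + b) = (+) (?B *v v) ` ((*v) ?B ` cbox a b)"
      by (simp only: cbox_translation image_image matrix_vector_right_distrib)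
    moreover have "cbox (v + a) (v + b) \<noteq> {}"
      using False by (simp add: cbox_translation)
    ultimately have "measure lebesgue ((+) (?B *v v) ` ((*v) ?B ` cbox a b)) = measure lebesgue (cbox (v + a) (v + b))"
      using shear[OF _ v, of "v + b"] by simp
    then show ?thesis by (simp add: measure_translation cbox_translation)
  qed simp
  with det show ?case
    by (intro lmeasurable_image_if_box_preserving) simp_all
qed

section \<open>Sublevel sets of homogeneous functions\<close>

text \<open>
  The real part of a positive homogeneous function, for one fixed exponent. That \<open>t\<^sup>E\<close> is contracting
  as \<open>t\<close> tends to \<open>0\<close> is a consequence of these axioms (\<open>orbit_enters_ball\<close>).
\<close>

locale homogeneous_function =
  fixes R :: "real^'d \<Rightarrow> real" and E :: "real^'d^'d"
  assumes cont: "continuous_on UNIV R"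
    and nonneg: "0 \<le> R \<xi>"
    and pos_def: "R \<xi> = 0 \<Longrightarrow> \<xi> = 0"
    and homogeneous: "0 < t \<Longrightarrow> R (real_powm t E *v \<xi>) = t * R \<xi>"
begin

lemma at_zero [simp]: "R 0 = 0"
  using homogeneous[of 2 0] by simp

lemma pos: "\<xi> \<noteq> 0 \<Longrightarrow> 0 < R \<xi>"
  using nonneg[of \<xi>] pos_def[of \<xi>] by (cases "R \<xi> = 0") auto

lemma positive_minimum:
  assumes "compact S" "0 \<notin> S"
  obtains m where "0 < m" "\<And>\<xi>. \<xi> \<in> S \<Longrightarrow> m \<le> R \<xi>"
proof (cases "S = {}")
  case False
  then obtain x where "x \<in> S" "\<And>y. y \<in> S \<Longrightarrow> R x \<le> R y"
    using continuous_attains_inf[OF assms(1) _ continuous_on_subset[OF cont]] by auto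
  with assms(2) show ?thesis by (intro that[of "R x"] pos) auto
qed (auto intro: that[of 1])

lemma orbit_crosses_sphere:
  assumes "0 < s" "s \<le> t" "norm (real_powm s E *v \<xi>) \<le> \<delta>" "\<delta> \<le> norm (real_powm t E *v \<xi>)"
  obtains u where "s \<le> u" "u \<le> t" "norm (real_powm u E *v \<xi>) = \<delta>"
proof -
  have "continuous_on {s..t} (\<lambda>t. norm (real_powm t E *v \<xi>))"
    using assms(1)
    by (intro continuous_on_norm continuous_on_subset[OF continuous_on_real_powm]) auto
  from IVT'[of "\<lambda>t. norm (real_powm t E *v \<xi>)", OF assms(3,4,2) this] show ?thesis
    using that by auto
qed

text \<open>
  An orbit that leaves the ball must meet its boundary at some parameter \<open>u \<le> 1\<close>, where \<open>R\<close> is at least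
  \<open>m\<close>; but \<open>R\<close> is \<open>u R(\<xi>) < m\<close> there.
\<close>

lemma orbit_stays_in_ball:
  assumes m: "\<And>\<eta>. norm \<eta> = \<delta> \<Longrightarrow> m \<le> R \<eta>"
    and "norm \<xi> < \<delta>" "R \<xi> < m" "0 < t" "t \<le> 1"
  shows "norm (real_powm t E *v \<xi>) < \<delta>"
proof (rule ccontr)
  assume contr: "\<not> ?thesis"
  have "continuous_on {t..1} (\<lambda>t. norm (real_powm t E *v \<xi>))"
    using assms(4)
    by (intro continuous_on_norm continuous_on_subset[OF continuous_on_real_powm]) auto
  then obtain u where u: "t \<le> u" "u \<le> 1" "norm (real_powm u E *v \<xi>) = \<delta>"
    using IVT2'[of "\<lambda>t. norm (real_powm t E *v \<xi>)" 1 \<delta> t] contr assms by auto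
  then have "m \<le> u * R \<xi>"
    using m[OF u(3)] homogeneous[of u \<xi>] u assms by simp
  also have "\<dots> \<le> 1 * R \<xi>"
    using u nonneg by (intro mult_right_mono) auto
  finally show False using assms by simp
qed

text \<open>
  By linearity it suffices to treat a small multiple \<open>c \<xi>\<close>, whose orbit stays in the ball of radius
  \<open>\<delta>\<close>. As \<open>R\<close> tends to \<open>0\<close> along the orbit while it is bounded below on the shell
  \<open>c \<delta> \<le> |\<eta>| \<le> \<delta>\<close>, the orbit of \<open>c \<xi>\<close> enters the ball of radius \<open>c \<delta>\<close>.
\<close>

lemma orbit_enters_ball:
  assumes "0 < \<delta>"
  obtains t where "0 < t" "t \<le> 1" "norm (real_powm t E *v \<xi>) < \<delta>"
proof -
  have "compact (sphere (0::real^'d) \<delta>)" "0 \<notin> sphere (0::real^'d) \<delta>"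
    using assms by auto
  from positive_minimum[OF this] obtain m
    where m: "0 < m" "\<And>\<eta>. norm \<eta> = \<delta> \<Longrightarrow> m \<le> R \<eta>" by auto
  have "((\<lambda>c. c *\<^sub>R \<xi>) \<longlongrightarrow> 0 *\<^sub>R \<xi>) (at_right 0)" by (intro tendsto_intros)
  then have l: "((\<lambda>c. c *\<^sub>R \<xi>) \<longlongrightarrow> 0) (at_right 0)" by simp
  moreover have "isCont R 0" using cont by (simp add: continuous_on_eq_continuous_at)
  ultimately have "((\<lambda>c. R (c *\<^sub>R \<xi>)) \<longlongrightarrow> 0) (at_right 0)"
    using isCont_tendsto_compose[of 0 R] by fastforce
  then have "eventually (\<lambda>c. R (c *\<^sub>R \<xi>) < m) (at_right 0)"
    using m(1) by (rule order_tendstoD(2))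
  moreover have "eventually (\<lambda>c. norm (c *\<^sub>R \<xi>) < \<delta>) (at_right 0)"
    using tendsto_norm[OF l] assms order_tendstoD(2)[of "\<lambda>c. norm (c *\<^sub>R \<xi>)" 0] by simp
  moreover have "eventually (\<lambda>c::real. 0 < c) (at_right 0)"
    by (simp add: eventually_at_right_less)
  ultimately have "eventually (\<lambda>c. R (c *\<^sub>R \<xi>) < m \<and> norm (c *\<^sub>R \<xi>) < \<delta> \<and> 0 < c) (at_right 0)"
    by eventually_elim auto
  then obtain c where c: "R (c *\<^sub>R \<xi>) < m" "norm (c *\<^sub>R \<xi>) < \<delta>" "0 < c"
    using eventually_happens by fastforce
  have "compact (cball (0::real^'d) \<delta> - ball 0 (c * \<delta>))" "0 \<notin> cball (0::real^'d) \<delta> - ball 0 (c * \<delta>)"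
    using assms c by (auto intro: compact_diff)
  from positive_minimum[OF this] obtain k
    where "0 < k" and kR: "\<And>\<eta>. \<eta> \<in> cball 0 \<delta> - ball 0 (c * \<delta>) \<Longrightarrow> k \<le> R \<eta>" by blast
  have k: "0 < k" "\<And>\<eta>. norm \<eta> \<le> \<delta> \<Longrightarrow> c * \<delta> \<le> norm \<eta> \<Longrightarrow> k \<le> R \<eta>"
    using \<open>0 < k\<close> kR by auto
  \<comment> \<open>Any positive \<open>t \<le> 1\<close> with \<open>t R(c \<xi>) < k\<close> would do; adding \<open>1\<close> avoids dividing by zero.\<close>
  define t where "t = min 1 (k / (2 * (R (c *\<^sub>R \<xi>) + 1)))"
  have t: "0 < t" "t \<le> 1" using k(1) nonneg[of "c *\<^sub>R \<xi>"] by (auto simp: t_def)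
  have "t * R (c *\<^sub>R \<xi>) \<le> k / (2 * (R (c *\<^sub>R \<xi>) + 1)) * R (c *\<^sub>R \<xi>)"
    using nonneg by (intro mult_right_mono) (auto simp: t_def)
  also have "\<dots> = (k / 2) * (R (c *\<^sub>R \<xi>) / (R (c *\<^sub>R \<xi>) + 1))" by simp
  also have "\<dots> \<le> (k / 2) * 1"
    using k(1) nonneg[of "c *\<^sub>R \<xi>"] by (intro mult_left_mono) auto
  also have "\<dots> < k" using k(1) by simp
  finally have "R (real_powm t E *v (c *\<^sub>R \<xi>)) < k"
    using homogeneous t by simp
  moreover have "norm (real_powm t E *v (c *\<^sub>R \<xi>)) < \<delta>"
    by (rule orbit_stays_in_ball[OF m(2) c(2) c(1) t])
  ultimately have "norm (real_powm t E *v (c *\<^sub>R \<xi>)) < c * \<delta>"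
    using k(2)[of "real_powm t E *v (c *\<^sub>R \<xi>)"] by (cases "c * \<delta> \<le> norm (real_powm t E *v (c *\<^sub>R \<xi>))") auto
  then have "norm (real_powm t E *v \<xi>) < \<delta>"
    using c(3) by (simp add: matrix_vector_mult_scaleR)
  with t that show ?thesis by blast
qed

text \<open>
  A point outside the ball has an orbit that enters the ball, hence crosses the sphere at some
  \<open>u \<le> 1\<close>; so its own value of \<open>R\<close> is at least the minimum of \<open>R\<close> on the sphere.
\<close>

lemma sublevel_subset_ball:
  assumes "0 < \<delta>"
  obtains m where "0 < m" "{\<xi>. R \<xi> < m} \<subseteq> ball 0 \<delta>"
proof -
  have "compact (sphere (0::real^'d) \<delta>)" "0 \<notin> sphere (0::real^'d) \<delta>"
    using assms by auto
  from positive_minimum[OF this] obtain m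
    where m: "0 < m" "\<And>\<eta>. norm \<eta> = \<delta> \<Longrightarrow> m \<le> R \<eta>" by auto
  have "m \<le> R \<xi>" if far: "\<delta> \<le> norm \<xi>" for \<xi>
  proof -
    obtain t where t: "0 < t" "t \<le> 1" "norm (real_powm t E *v \<xi>) < \<delta>"
      using orbit_enters_ball[OF assms] .
    obtain u where u: "t \<le> u" "u \<le> 1" "norm (real_powm u E *v \<xi>) = \<delta>"
      using orbit_crosses_sphere[of t 1 \<xi> \<delta>] t far by auto
    then have "m \<le> u * R \<xi>"
      using m(2)[OF u(3)] homogeneous[of u \<xi>] t by simp
    also have "\<dots> \<le> 1 * R \<xi>"
      using u nonneg by (intro mult_right_mono) auto
    finally show ?thesis by simp
  qed
  then have "{\<xi>. R \<xi> < m} \<subseteq> ball 0 \<delta>" by (auto simp: not_le[symmetric])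
  with m(1) that show ?thesis by blast
qed

lemma sublevel_scaling:
  assumes "0 < t"
  shows "(*v) (real_powm t E) ` {\<xi>. R \<xi> < s} = {\<xi>. R \<xi> < t * s}"
proof (intro set_eqI iffI)
  fix \<xi> assume "\<xi> \<in> {\<xi>. R \<xi> < t * s}"
  then have "t * R (real_powm (1 / t) E *v \<xi>) < t * s"
    using assms homogeneous[of "1 / t" \<xi>] by simp
  then have "R (real_powm (1 / t) E *v \<xi>) < s"
    using assms by simp
  moreover have "\<xi> = real_powm t E *v (real_powm (1 / t) E *v \<xi>)"
    by (rule real_powm_inverse(1)[OF assms, symmetric])
  ultimately show "\<xi> \<in> (*v) (real_powm t E) ` {\<xi>. R \<xi> < s}" by blast
qed (use assms homogeneous in auto)

lemma open_sublevel: "open {\<xi>. R \<xi> < s}"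
  using open_Collect_less[OF cont continuous_on_const, of s] .

text \<open>
  All sublevel sets are images of one bounded sublevel set under \<open>t\<^sup>E\<close>, whose determinant is \<open>t\<close> to
  the power \<open>tr E\<close>.
\<close>

lemma sublevel_measure:
  obtains V where "0 \<le> V"
    "\<And>s. 0 < s \<Longrightarrow> emeasure lborel {\<xi>. R \<xi> < s} = ennreal (V * s powr trace E)"
proof -
  obtain m where m: "0 < m" "{\<xi>. R \<xi> < m} \<subseteq> ball 0 1"
    using sublevel_subset_ball[of 1] by auto
  have fin: "{\<xi>. R \<xi> < m} \<in> lmeasurable"
    using m(2) by (intro lmeasurable_open open_sublevel) (auto intro: bounded_subset[OF bounded_ball])
  let ?V = "measure lebesgue {\<xi>. R \<xi> < m}"
  have "emeasure lborel {\<xi>. R \<xi> < s} = ennreal (?V * m powr (- trace E) * s powr trace E)" if "0 < s" for s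
  proof -
    have sm: "0 < s / m" using m that by simp
    have eq: "(*v) (real_powm (s / m) E) ` {\<xi>. R \<xi> < m} = {\<xi>. R \<xi> < s}"
      using sublevel_scaling[OF sm, of m] m(1) by simp
    have "{\<xi>. R \<xi> < s} \<in> lmeasurable"
      "measure lebesgue {\<xi>. R \<xi> < s} = \<bar>det (real_powm (s / m) E)\<bar> * ?V"
      using lmeasurable_matrix_image[of "real_powm (s / m) E"] fin unfolding eq[symmetric] by blast+
    moreover have "{\<xi>. R \<xi> < s} \<in> sets borel"
      by (simp add: open_sublevel)
    ultimately have "emeasure lborel {\<xi>. R \<xi> < s} = ennreal (\<bar>det (real_powm (s / m) E)\<bar> * ?V)"
      using emeasure_eq_measure2[of "{\<xi>. R \<xi> < s}" lebesgue] by simp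
    also have "\<bar>det (real_powm (s / m) E)\<bar> = m powr (- trace E) * s powr trace E"
      using m(1) that by (simp add: det_real_powm[OF sm] powr_divide powr_minus divide_simps)
    finally show ?thesis by (simp add: mult_ac)
  qed
  then show ?thesis by (intro that[of "?V * m powr (- trace E)"]) auto
qed

text \<open>
  Slicing into the layers \<open>k \<le> n R < k + 1\<close> bounds the integral by the sum over \<open>k\<close> of \<open>exp(- c k)\<close> times
  the volume of \<open>{R < (k + 1) / n}\<close>. By \<open>sublevel_measure\<close> the dependence on \<open>n\<close> factors out, and the
  remaining series converges.
\<close>

lemma nn_integral_exp_le:
  assumes c: "0 < c"
  shows "\<exists>C>0. \<forall>n\<ge>1. (\<integral>\<^sup>+ \<xi>. ennreal (exp (- (c * real n * R \<xi>))) \<partial>lborel)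
    \<le> ennreal (C * real n powr (- trace E))"
proof -
  obtain V where V: "0 \<le> V"
    "\<And>s. 0 < s \<Longrightarrow> emeasure lborel {\<xi>. R \<xi> < s} = ennreal (V * s powr trace E)"
    using sublevel_measure by blast
  let ?a = "\<lambda>k. exp (- c * real k) * real (Suc k) powr trace E"
  have summ: "summable ?a"
  proof (rule summable_comparison_test_bigo)
    show "summable (\<lambda>k. norm (exp (- c / 2) ^ k))"
      using c by (simp add: norm_power summable_geometric)
    have "(\<lambda>k. ?a k) \<in> O(\<lambda>k. exp (- c / 2 * real k))"
      using c by real_asymp
    then show "?a \<in> O(\<lambda>k. exp (- c / 2) ^ k)"
      by (simp add: exp_of_nat_mult[symmetric] mult.commute)
  qed
  \<comment> \<open>The summand \<open>1\<close> only serves to make the constant positive.\<close>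
  have "(\<integral>\<^sup>+ \<xi>. ennreal (exp (- (c * real n * R \<xi>))) \<partial>lborel)
      \<le> ennreal ((V * suminf ?a + 1) * real n powr (- trace E))" if n: "n \<ge> 1" for n
  proof -
    let ?S = "\<lambda>k. {\<xi>. R \<xi> < real (Suc k) / real n}"
    have meas: "?S k \<in> sets lborel" for k by (simp add: open_sublevel)
    have "(\<integral>\<^sup>+ \<xi>. ennreal (exp (- (c * real n * R \<xi>))) \<partial>lborel)
        \<le> (\<integral>\<^sup>+ \<xi>. (\<Sum>k. ennreal (exp (- c * real k)) * indicator (?S k) \<xi>) \<partial>lborel)"
    proof (rule nn_integral_mono)
      fix \<xi>
      define k where "k = nat \<lfloor>real n * R \<xi>\<rfloor>"
      have k: "real k \<le> real n * R \<xi>" "real n * R \<xi> < real (Suc k)"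
        using nonneg[of \<xi>] by (auto simp: k_def) linarith
      have "ennreal (exp (- (c * real n * R \<xi>))) \<le> ennreal (exp (- c * real k)) * indicator (?S k) \<xi>"
        using k n c by (auto simp: indicator_def field_simps intro!: ennreal_leI)
      also have "\<dots> \<le> (\<Sum>k. ennreal (exp (- c * real k)) * indicator (?S k) \<xi>)"
      proof -
        have "sum f {k} \<le> suminf f" for f :: "nat \<Rightarrow> ennreal"
          by (rule sum_le_suminf) auto
        from this[of "\<lambda>k. ennreal (exp (- c * real k)) * indicator (?S k) \<xi>"] show ?thesis
          by (simp only: sum.insert sum.empty finite.emptyI empty_iff not_False_eq_True add_0_right)
      qed
      finally show "ennreal (exp (- (c * real n * R \<xi>))) \<le> (\<Sum>k. ennreal (exp (- c * real k)) * indicator (?S k) \<xi>)" .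
    qed
    also have "\<dots> = (\<Sum>k. \<integral>\<^sup>+ \<xi>. ennreal (exp (- c * real k)) * indicator (?S k) \<xi> \<partial>lborel)"
      using meas by (intro nn_integral_suminf) auto
    also have "\<dots> = (\<Sum>k. ennreal (exp (- c * real k)) * emeasure lborel (?S k))"
      using meas by (intro suminf_cong nn_integral_cmult_indicator)
    also have "\<dots> = (\<Sum>k. ennreal (V * real n powr (- trace E) * ?a k))"
    proof (rule suminf_cong)
      fix k
      have "emeasure lborel (?S k) = ennreal (V * (real (Suc k) / real n) powr trace E)"
        using n by (intro V(2)) auto
      then show "ennreal (exp (- c * real k)) * emeasure lborel (?S k) = ennreal (V * real n powr (- trace E) * ?a k)"
        using n V(1) by (simp add: ennreal_mult[symmetric] powr_divide powr_minus field_simps)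
    qed
    also have "\<dots> = ennreal (\<Sum>k. V * real n powr (- trace E) * ?a k)"
      using V(1) summ by (intro suminf_ennreal2 summable_mult) auto
    also have "(\<Sum>k. V * real n powr (- trace E) * ?a k) = V * suminf ?a * real n powr (- trace E)"
      using summ by (simp add: suminf_mult)
    also have "\<dots> \<le> (V * suminf ?a + 1) * real n powr (- trace E)"
      by (intro mult_right_mono) auto
    finally show ?thesis by (simp add: ennreal_leI)
  qed
  moreover have "0 < V * suminf ?a + 1"
    using V(1) summ by (intro add_nonneg_pos mult_nonneg_nonneg suminf_nonneg) auto
  ultimately show ?thesis by blast
qed

end

section \<open>Absolutely summable functions on the lattice and their Fourier transforms\<close>

abbreviation l1 :: "('i \<Rightarrow> complex) \<Rightarrow> bool" where
  "l1 a \<equiv> (\<lambda>x. norm (a x)) summable_on UNIV"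

definition lattice_char :: "int ^ 'd \<Rightarrow> real ^ 'd \<Rightarrow> complex" where
  "lattice_char x \<xi> = exp (\<i> * complex_of_real (real_vec x \<bullet> \<xi>))"

lemma norm_lattice_char [simp]: "norm (lattice_char x \<xi>) = 1"
  by (simp add: lattice_char_def)

lemma lattice_char_add: "lattice_char x (\<xi> + \<eta>) = lattice_char x \<xi> * lattice_char x \<eta>"
  by (simp add: lattice_char_def inner_add_right exp_add[symmetric] algebra_simps)

lemma lattice_char_add_left: "lattice_char (x + y) \<xi> = lattice_char x \<xi> * lattice_char y \<xi>"
proof -
  have "real_vec (x + y) = real_vec x + real_vec y" by (simp add: real_vec_def vec_eq_iff)
  then show ?thesis
    by (simp add: lattice_char_def inner_add_left exp_add[symmetric] algebra_simps)
qed

lemma cnj_lattice_char: "cnj (lattice_char x \<xi>) = lattice_char x (- \<xi>)"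
  by (simp add: lattice_char_def exp_cnj)

lemma lattice_char_minus_left: "lattice_char (- x) \<xi> = lattice_char x (- \<xi>)"
proof -
  have "real_vec (- x) = - real_vec x" by (simp add: real_vec_def vec_eq_iff)
  then show ?thesis by (simp add: lattice_char_def)
qed

lemma continuous_on_lattice_char [continuous_intros]:
  "continuous_on S f \<Longrightarrow> continuous_on S (\<lambda>\<xi>. lattice_char x (f \<xi>))"
  unfolding lattice_char_def by (intro continuous_intros)

lemma fourier_eq: "fourier a \<xi> = (\<Sum>\<^sub>\<infinity>x. a x * lattice_char x \<xi>)"
  by (simp add: fourier_def lattice_char_def)

lemma abs_summable_lattice_char:
  "l1 a \<Longrightarrow> l1 (\<lambda>x. a x * lattice_char x \<xi>)"
  by (simp add: norm_mult)

lemma norm_fourier_le: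
  assumes "l1 a" shows "norm (fourier a \<xi>) \<le> (\<Sum>\<^sub>\<infinity>x. norm (a x))"
  using norm_infsum_bound[OF abs_summable_lattice_char[OF assms]]
  by (simp add: fourier_eq norm_mult)

lemma continuous_on_fourier:
  assumes "l1 a" shows "continuous_on UNIV (fourier a)"
proof -
  have "uniform_limit UNIV (\<lambda>X \<xi>. \<Sum>x\<in>X. a x * lattice_char x \<xi>)
      (\<lambda>\<xi>. \<Sum>\<^sub>\<infinity>x. a x * lattice_char x \<xi>) (finite_subsets_at_top UNIV)"
    using assms by (intro Weierstrass_m_test_general) (auto simp: norm_mult)
  then have "continuous_on UNIV (\<lambda>\<xi>. \<Sum>\<^sub>\<infinity>x. a x * lattice_char x \<xi>)"
    by (rule uniform_limit_theorem[rotated]) (auto intro!: always_eventually continuous_intros)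
  then show ?thesis by (simp add: fourier_eq[abs_def])
qed

lemma fourier_periodic:
  assumes "\<And>i. \<exists>k::int. v $ i = 2 * pi * k"
  shows "fourier a (\<xi> + v) = fourier a \<xi>"
proof -
  have "lattice_char x v = 1" for x
  proof -
    obtain k :: "_ \<Rightarrow> int" where k: "\<And>i. v $ i = 2 * pi * k i"
      using assms by metis
    have "real_vec x \<bullet> v = of_int (\<Sum>i\<in>UNIV. x $ i * k i) * (2 * pi)"
      by (simp add: inner_vec_def real_vec_def k sum_distrib_left sum_distrib_right algebra_simps)
    then have "\<i> * complex_of_real (real_vec x \<bullet> v) = \<i> * (of_int (\<Sum>i\<in>UNIV. x $ i * k i) * (of_real pi * 2))"
      by simp
    then show ?thesis unfolding lattice_char_def by (simp only: exp_2pi_1_int)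
  qed
  then show ?thesis by (simp add: fourier_eq lattice_char_add)
qed

lemma l1_product:
  assumes "l1 a" "l1 b"
  shows "(\<lambda>p. norm ((\<lambda>(x, y). a x * b y) p)) summable_on UNIV \<times> UNIV"
  using assms
  by (subst Infinite_Sum.abs_summable_on_Sigma_iff)
     (auto simp: norm_mult infsum_cmult_right' abs_mult infsum_nonneg
        intro: summable_on_cmult_left summable_on_cmult_right)

lemma
  fixes a b :: "int ^ 'd \<Rightarrow> complex"
  assumes a: "l1 a" and b: "l1 b"
  shows abs_summable_convolution: "l1 (convolution a b)"
    and infsum_convolution: "(\<Sum>\<^sub>\<infinity>x. convolution a b x) = (\<Sum>\<^sub>\<infinity>x. a x) * (\<Sum>\<^sub>\<infinity>x. b x)"
proof -
  let ?F = "\<lambda>(x, y). a (x - y) * b y" and ?G = "\<lambda>(x, y). a x * b y"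
  let ?s = "\<lambda>(x, y). (x + y, y)"
  have bij: "bij_betw ?s (UNIV \<times> UNIV) (UNIV \<times> (UNIV :: (int ^ 'd) set))"
    by (rule bij_betwI[where g = "\<lambda>(x, y). (x - y, y)"]) auto
  have F: "?F (?s p) = ?G p" for p by (cases p) simp
  have G: "(\<lambda>p. norm (?G p)) summable_on UNIV \<times> UNIV" by (rule l1_product[OF a b])
  then have Fsum: "(\<lambda>p. norm (?F p)) summable_on UNIV \<times> UNIV"
    using summable_on_reindex_bij_betw[OF bij, of "\<lambda>p. norm (?F p)"] by (simp only: F)
  then have "(\<forall>x. l1 (\<lambda>y. a (x - y) * b y)) \<and>
      (\<lambda>x. norm (\<Sum>\<^sub>\<infinity>y. norm (a (x - y) * b y))) summable_on UNIV"
    unfolding Infinite_Sum.abs_summable_on_Sigma_iff by simp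
  then have rows: "\<And>x. l1 (\<lambda>y. a (x - y) * b y)"
    and total: "(\<lambda>x. norm (\<Sum>\<^sub>\<infinity>y. norm (a (x - y) * b y))) summable_on UNIV"
    by auto
  show "l1 (convolution a b)"
  proof (rule Infinite_Sum.abs_summable_on_comparison_test[OF total])
    fix x
    have "norm (convolution a b x) \<le> (\<Sum>\<^sub>\<infinity>y. norm (a (x - y) * b y))"
      unfolding convolution_def by (rule norm_infsum_bound[OF rows])
    then show "norm (convolution a b x) \<le> norm (\<Sum>\<^sub>\<infinity>y. norm (a (x - y) * b y))" by simp
  qed
  have "(\<Sum>\<^sub>\<infinity>x. convolution a b x) = infsum ?F (UNIV \<times> UNIV)"
    unfolding convolution_def
    using infsum_Sigma_banach[OF abs_summable_summable[OF Fsum]] by simp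
  also have "\<dots> = infsum ?G (UNIV \<times> UNIV)"
    using infsum_reindex_bij_betw[OF bij, of ?F] by (simp only: F)
  also have "\<dots> = (\<Sum>\<^sub>\<infinity>x. \<Sum>\<^sub>\<infinity>y. a x * b y)"
    using infsum_Sigma_banach[OF abs_summable_summable[OF G]] by simp
  also have "\<dots> = (\<Sum>\<^sub>\<infinity>x. a x) * (\<Sum>\<^sub>\<infinity>x. b x)"
    by (simp add: infsum_cmult_right' infsum_cmult_left')
  finally show "(\<Sum>\<^sub>\<infinity>x. convolution a b x) = (\<Sum>\<^sub>\<infinity>x. a x) * (\<Sum>\<^sub>\<infinity>x. b x)" .
qed

lemma fourier_convolution:
  assumes "l1 a" "l1 b"
  shows "fourier (convolution a b) \<xi> = fourier a \<xi> * fourier b \<xi>"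
proof -
  have "convolution a b x * lattice_char x \<xi>
      = convolution (\<lambda>x. a x * lattice_char x \<xi>) (\<lambda>x. b x * lattice_char x \<xi>) x" for x
  proof -
    have "lattice_char x \<xi> = lattice_char (x - y) \<xi> * lattice_char y \<xi>" for y
      using lattice_char_add_left[of "x - y" y] by simp
    then have "a (x - y) * b y * lattice_char x \<xi>
        = a (x - y) * lattice_char (x - y) \<xi> * (b y * lattice_char y \<xi>)" for y
      by (simp only: mult_ac)
    then show ?thesis
      by (simp only: convolution_def infsum_cmult_left'[symmetric])
  qed
  then show ?thesis
    using infsum_convolution[OF assms[THEN abs_summable_lattice_char]] by (simp add: fourier_eq)
qed

lemma
  assumes "l1 a" and "1 \<le> n"
  shows abs_summable_conv_power: "l1 (conv_power a n)"
    and fourier_conv_power: "fourier (conv_power a n) \<xi> = fourier a \<xi> ^ n"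
proof -
  have "l1 (conv_power a n) \<and> fourier (conv_power a n) \<xi> = fourier a \<xi> ^ n"
    using \<open>1 \<le> n\<close>
  proof (induction n rule: dec_induct)
    case (step n)
    then obtain m where "n = Suc m" by (cases n) auto
    with step assms(1) show ?case
      by (simp add: abs_summable_convolution fourier_convolution)
  qed (use assms in simp)
  then show "l1 (conv_power a n)" "fourier (conv_power a n) \<xi> = fourier a \<xi> ^ n"
    by auto
qed

lemma S_space_abs_summable:
  assumes "\<phi> \<in> S_space" shows "l1 \<phi>"
proof -
  have "(\<lambda>x. norm (of_int (lattice_monom 0 x) * \<phi> x)) summable_on UNIV"
    using assms unfolding S_space_def by blast
  then show ?thesis by (simp add: lattice_monom_def)
qed

lemma borel_measurable_cnj:
  "f \<in> borel_measurable M \<Longrightarrow> (\<lambda>\<eta>. cnj (f \<eta>)) \<in> borel_measurable M"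
  by (rule measurable_compose[OF _ borel_measurable_continuous_onI[OF continuous_on_cnj[OF continuous_on_id]]])

text \<open>
  The partial sums converge uniformly, so they may be integrated term by term over a finite measure.
\<close>

lemma has_sum_integral:
  fixes a :: "'i \<Rightarrow> complex" and g :: "'i \<Rightarrow> 'b \<Rightarrow> complex"
  assumes M: "finite_measure M" and a: "l1 a"
    and g: "\<And>x. g x \<in> borel_measurable M" "\<And>x \<eta>. \<eta> \<in> space M \<Longrightarrow> norm (g x \<eta>) \<le> 1"
    and G: "(\<lambda>\<eta>. \<Sum>\<^sub>\<infinity>x. a x * g x \<eta>) \<in> borel_measurable M"
  shows "((\<lambda>x. a x * integral\<^sup>L M (g x)) has_sum (\<integral>\<eta>. (\<Sum>\<^sub>\<infinity>x. a x * g x \<eta>) \<partial>M)) UNIV"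
proof -
  interpret finite_measure M by (rule M)
  let ?G = "\<lambda>\<eta>. \<Sum>\<^sub>\<infinity>x. a x * g x \<eta>"
  have bd: "norm (a x * g x \<eta>) \<le> norm (a x)" if "\<eta> \<in> space M" for x \<eta>
    using g(2)[OF that, of x] by (simp add: norm_mult mult_left_le)
  have gint: "integrable M (g x)" for x
    using g by (intro integrable_const_bound[of _ 1]) auto
  have "norm (?G \<eta>) \<le> (\<Sum>\<^sub>\<infinity>x. norm (a x))" if "\<eta> \<in> space M" for \<eta>
  proof -
    have s: "l1 (\<lambda>x. a x * g x \<eta>)"
      using bd[OF that] by (intro Infinite_Sum.abs_summable_on_comparison_test[OF a]) auto
    show ?thesis
      using norm_infsum_bound[OF s] infsum_mono[OF s a] bd[OF that] by fastforce
  qed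
  then have Gint: "integrable M ?G"
    using G by (intro integrable_const_bound[of _ "\<Sum>\<^sub>\<infinity>x. norm (a x)"]) auto
  have lim: "uniform_limit (space M) (\<lambda>X \<eta>. \<Sum>x\<in>X. a x * g x \<eta>) ?G (finite_subsets_at_top UNIV)"
    using bd a by (intro Weierstrass_m_test_general) auto
  show ?thesis
    unfolding has_sum_def
  proof (rule tendstoI)
    fix e :: real assume "0 < e"
    define d where "d = measure M (space M) + 1"
    define e' where "e' = e / 2 / d"
    have e': "0 < e'" "e' * measure M (space M) < e"
    proof -
      have pos: "0 < d" by (simp add: d_def add_nonneg_pos)
      then show "0 < e'" using \<open>0 < e\<close> by (simp add: e'_def)
      have "e' * measure M (space M) \<le> e' * d"
        using \<open>0 < e'\<close> by (simp add: d_def)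
      also have "\<dots> = e / 2" using pos by (simp add: e'_def)
      also have "\<dots> < e" using \<open>0 < e\<close> by simp
      finally show "e' * measure M (space M) < e" .
    qed
    have "eventually (\<lambda>X. finite X) (finite_subsets_at_top (UNIV :: 'i set))"
      by (simp add: eventually_finite_subsets_at_top) blast
    moreover have "eventually (\<lambda>X. \<forall>\<eta>\<in>space M. dist (\<Sum>x\<in>X. a x * g x \<eta>) (?G \<eta>) < e') (finite_subsets_at_top UNIV)"
      using uniform_limitD[OF lim e'(1)] .
    ultimately show "eventually (\<lambda>X. dist (\<Sum>x\<in>X. a x * integral\<^sup>L M (g x)) (integral\<^sup>L M ?G) < e) (finite_subsets_at_top UNIV)"
    proof eventually_elim
      fix X assume X: "finite X" "\<forall>\<eta>\<in>space M. dist (\<Sum>x\<in>X. a x * g x \<eta>) (?G \<eta>) < e'"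
      have "(\<Sum>x\<in>X. a x * integral\<^sup>L M (g x)) - integral\<^sup>L M ?G = (\<integral>\<eta>. (\<Sum>x\<in>X. a x * g x \<eta>) - ?G \<eta> \<partial>M)"
        using gint Gint by simp
      also have "norm \<dots> \<le> (\<integral>\<eta>. norm ((\<Sum>x\<in>X. a x * g x \<eta>) - ?G \<eta>) \<partial>M)"
        by (rule integral_norm_bound)
      also have "\<dots> \<le> (\<integral>\<eta>. e' \<partial>M)"
        using gint Gint X(2)
        by (intro integral_mono integrable_norm Bochner_Integration.integrable_diff
            Bochner_Integration.integrable_sum integrable_mult_right) (auto simp: dist_norm less_imp_le)
      also have "\<dots> < e" using e'(2) by (simp add: mult.commute)
      finally show "dist (\<Sum>x\<in>X. a x * integral\<^sup>L M (g x)) (integral\<^sup>L M ?G) < e"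
        by (simp add: dist_norm)
    qed
  qed
qed

text \<open>
  As usual, this is the nonnegativity of the squared distance from \<open>f\<close> to the projection
  \<open>(1 / c) \<Sum> a x cnj (u x)\<close>, where \<open>a x\<close> is the integral of \<open>f (u x)\<close>.
\<close>

lemma bessel_inequality:
  fixes f :: "'b \<Rightarrow> complex" and u :: "'i \<Rightarrow> 'b \<Rightarrow> complex"
  assumes M: "finite_measure M" and c: "0 < c"
    and f: "f \<in> borel_measurable M" "\<And>\<eta>. \<eta> \<in> space M \<Longrightarrow> norm (f \<eta>) \<le> B"
    and u: "\<And>x. u x \<in> borel_measurable M" "\<And>x \<eta>. \<eta> \<in> space M \<Longrightarrow> norm (u x \<eta>) \<le> 1"
    and orth: "\<And>x y. (\<integral>\<eta>. u x \<eta> * cnj (u y \<eta>) \<partial>M) = (if x = y then complex_of_real c else 0)"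
    and X: "finite X"
  shows "(\<Sum>x\<in>X. (norm (\<integral>\<eta>. f \<eta> * u x \<eta> \<partial>M))\<^sup>2) \<le> c * (\<integral>\<eta>. (norm (f \<eta>))\<^sup>2 \<partial>M)"
proof -
  interpret finite_measure M by (rule M)
  define a where "a x = (\<integral>\<eta>. f \<eta> * u x \<eta> \<partial>M)" for x
  define h where "h \<eta> = (\<Sum>x\<in>X. a x * cnj (u x \<eta>))" for \<eta>
  have int: "integrable M (\<lambda>\<eta>. p \<eta> * q \<eta>)"
    if "p \<in> borel_measurable M" "\<And>\<eta>. \<eta> \<in> space M \<Longrightarrow> norm (p \<eta>) \<le> C"
      "q \<in> borel_measurable M" "\<And>\<eta>. \<eta> \<in> space M \<Longrightarrow> norm (q \<eta>) \<le> D"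
    for p q :: "'b \<Rightarrow> complex" and C D
    using that by (intro integrable_const_bound[of _ "C * D"])
      (auto simp: norm_mult intro!: mult_mono AE_I2 order_trans[OF norm_ge_zero])
  have cu: "(\<lambda>\<eta>. cnj (u x \<eta>)) \<in> borel_measurable M" "\<eta> \<in> space M \<Longrightarrow> norm (cnj (u x \<eta>)) \<le> 1" for x \<eta>
    using u borel_measurable_cnj[OF u(1)]
    by auto
  have cf: "(\<lambda>\<eta>. cnj (f \<eta>)) \<in> borel_measurable M" "\<eta> \<in> space M \<Longrightarrow> norm (cnj (f \<eta>)) \<le> B" for \<eta>
    using f borel_measurable_cnj[OF f(1)]
    by auto
  have ff: "integrable M (\<lambda>\<eta>. f \<eta> * cnj (f \<eta>))" by (rule int[OF f cf])
  have fu: "integrable M (\<lambda>\<eta>. f \<eta> * u x \<eta>)" for x by (rule int[OF f u])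
  have cfu: "integrable M (\<lambda>\<eta>. cnj (f \<eta>) * cnj (u x \<eta>))" for x by (rule int[OF cf cu])
  have uu: "integrable M (\<lambda>\<eta>. cnj (u x \<eta>) * u y \<eta>)" for x y by (rule int[OF cu u])
  have cfu_val: "(\<integral>\<eta>. cnj (f \<eta>) * cnj (u x \<eta>) \<partial>M) = cnj (a x)" for x
    unfolding a_def by (simp flip: complex_cnj_mult)
  have uu_val: "(\<integral>\<eta>. cnj (u x \<eta>) * u y \<eta> \<partial>M) = (if x = y then complex_of_real c else 0)" for x y
    using orth[of y x] by (simp add: mult.commute)
  have fh: "integrable M (\<lambda>\<eta>. f \<eta> * cnj (h \<eta>))" "(\<integral>\<eta>. f \<eta> * cnj (h \<eta>) \<partial>M) = (\<Sum>x\<in>X. cnj (a x) * a x)"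
  proof -
    have "f \<eta> * cnj (h \<eta>) = (\<Sum>x\<in>X. cnj (a x) * (f \<eta> * u x \<eta>))" for \<eta>
      by (simp add: h_def sum_distrib_left mult_ac)
    then show "integrable M (\<lambda>\<eta>. f \<eta> * cnj (h \<eta>))" "(\<integral>\<eta>. f \<eta> * cnj (h \<eta>) \<partial>M) = (\<Sum>x\<in>X. cnj (a x) * a x)"
      using fu by (simp_all add: a_def)
  qed
  have hf: "integrable M (\<lambda>\<eta>. h \<eta> * cnj (f \<eta>))" "(\<integral>\<eta>. h \<eta> * cnj (f \<eta>) \<partial>M) = (\<Sum>x\<in>X. a x * cnj (a x))"
  proof -
    have "h \<eta> * cnj (f \<eta>) = (\<Sum>x\<in>X. a x * (cnj (f \<eta>) * cnj (u x \<eta>)))" for \<eta>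
      by (simp add: h_def sum_distrib_left mult_ac)
    then show "integrable M (\<lambda>\<eta>. h \<eta> * cnj (f \<eta>))" "(\<integral>\<eta>. h \<eta> * cnj (f \<eta>) \<partial>M) = (\<Sum>x\<in>X. a x * cnj (a x))"
      using cfu by (simp_all only: Bochner_Integration.integrable_sum integrable_mult_right
          Bochner_Integration.integral_sum integral_mult_right_zero cfu_val)
  qed
  have hh_eq: "h \<eta> * cnj (h \<eta>) = (\<Sum>x\<in>X. \<Sum>y\<in>X. a x * cnj (a y) * (cnj (u x \<eta>) * u y \<eta>))" for \<eta>
    by (simp add: h_def sum_product mult_ac)
  have hh: "integrable M (\<lambda>\<eta>. h \<eta> * cnj (h \<eta>))"
    "(\<integral>\<eta>. h \<eta> * cnj (h \<eta>) \<partial>M) = (\<Sum>x\<in>X. a x * cnj (a x) * complex_of_real c)"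
    unfolding hh_eq using uu X by (simp_all add: uu_val if_distrib cong: if_cong)
  let ?r = "complex_of_real (1 / c)"
  let ?A = "\<Sum>x\<in>X. (norm (a x))\<^sup>2"
  have A: "(\<Sum>x\<in>X. a x * cnj (a x)) = complex_of_real ?A" "(\<Sum>x\<in>X. cnj (a x) * a x) = complex_of_real ?A"
    by (simp_all add: complex_norm_square mult.commute[of "cnj _"] del: of_real_power)
  have expand: "complex_of_real ((norm (f \<eta> - ?r * h \<eta>))\<^sup>2)
      = f \<eta> * cnj (f \<eta>) - ?r * (f \<eta> * cnj (h \<eta>)) - ?r * (h \<eta> * cnj (f \<eta>)) + ?r * ?r * (h \<eta> * cnj (h \<eta>))" for \<eta>
    by (simp add: complex_norm_square algebra_simps del: of_real_power)
  have "complex_of_real (\<integral>\<eta>. (norm (f \<eta> - ?r * h \<eta>))\<^sup>2 \<partial>M) = (\<integral>\<eta>. complex_of_real ((norm (f \<eta> - ?r * h \<eta>))\<^sup>2) \<partial>M)"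
    by (rule integral_complex_of_real[symmetric])
  also have "\<dots> = (\<integral>\<eta>. f \<eta> * cnj (f \<eta>) \<partial>M) - ?r * complex_of_real ?A - ?r * complex_of_real ?A
      + ?r * ?r * (complex_of_real ?A * complex_of_real c)"
    unfolding expand using ff fh hf hh
    by (simp add: A flip: sum_distrib_right)
  also have "(\<integral>\<eta>. f \<eta> * cnj (f \<eta>) \<partial>M) = complex_of_real (\<integral>\<eta>. (norm (f \<eta>))\<^sup>2 \<partial>M)"
    by (simp add: complex_norm_square[symmetric] flip: integral_complex_of_real)
  also have "\<dots> - ?r * complex_of_real ?A - ?r * complex_of_real ?A + ?r * ?r * (complex_of_real ?A * complex_of_real c)
      = complex_of_real ((\<integral>\<eta>. (norm (f \<eta>))\<^sup>2 \<partial>M) - ?A / c)"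
    using c by (simp add: divide_simps) 
  finally have "(\<integral>\<eta>. (norm (f \<eta> - ?r * h \<eta>))\<^sup>2 \<partial>M) = (\<integral>\<eta>. (norm (f \<eta>))\<^sup>2 \<partial>M) - ?A / c"
    by (simp only: of_real_eq_iff)
  moreover have "0 \<le> (\<integral>\<eta>. (norm (f \<eta> - ?r * h \<eta>))\<^sup>2 \<partial>M)" by simp
  ultimately have "?A / c \<le> (\<integral>\<eta>. (norm (f \<eta>))\<^sup>2 \<partial>M)" by linarith
  then show ?thesis
    using c unfolding a_def by (simp add: pos_divide_le_eq mult.commute)
qed

section \<open>Fourier inversion on the cube\<close>

definition cube :: "(real ^ 'd) set" where
  "cube = cbox (\<chi> i. - pi) (\<chi> i. pi)"

definition cube_measure :: "(real ^ 'd) measure" where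
  "cube_measure = restrict_space lborel cube"

lemma mem_cube: "\<xi> \<in> cube \<longleftrightarrow> (\<forall>i. - pi \<le> \<xi> $ i \<and> \<xi> $ i \<le> pi)"
  by (simp add: cube_def mem_box_cart)

lemma compact_cube: "compact cube" by (simp add: cube_def)

lemma cube_sets [measurable]: "cube \<in> sets borel" by (simp add: cube_def)

lemma space_cube_measure [simp]: "space cube_measure = cube"
  by (simp add: cube_measure_def space_restrict_space)

lemma finite_cube_measure: "finite_measure cube_measure"
  unfolding cube_measure_def
  by (rule finite_measureI) (simp add: emeasure_restrict_space space_restrict_space cube_def emeasure_lborel_cbox_eq)

lemma measurable_cube_measureI: "f \<in> borel_measurable borel \<Longrightarrow> f \<in> borel_measurable cube_measure"
  unfolding cube_measure_def by (intro measurable_restrict_space1) simp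

lemma integral_cube_measure:
  fixes f :: "real ^ 'd \<Rightarrow> complex"
  shows "integral\<^sup>L cube_measure f = (\<integral>\<xi>. indicator cube \<xi> *\<^sub>R f \<xi> \<partial>lborel)"
  unfolding cube_measure_def by (rule integral_restrict_space) simp

lemma integral_circle_char:
  fixes k :: int
  shows "has_bochner_integral lborel
    (\<lambda>t. indicator {- pi..pi} t *\<^sub>R exp (\<i> * complex_of_real (real_of_int k * t)))
    (if k = 0 then complex_of_real (2 * pi) else 0)"
proof (cases "k = 0")
  case True
  have "has_bochner_integral lborel (\<lambda>t. indicator {- pi..pi} t *\<^sub>R (1 :: complex)) (measure lborel {- pi..pi} *\<^sub>R 1)"
    by (rule has_bochner_integral_indicator) auto
  with True show ?thesis by (simp add: scaleR_conv_of_real)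
next
  case False
  let ?F = "\<lambda>t. exp (\<i> * complex_of_real (real_of_int k * t)) / (\<i> * of_int k)"
  have deriv: "(?F has_vector_derivative exp (\<i> * complex_of_real (real_of_int k * t))) (at t within S)" for t S
    using False
    by (auto intro!: derivative_eq_intros has_vector_derivative_real_field simp: field_simps)
  have "exp (\<i> * complex_of_real (real_of_int k * pi)) = exp (\<i> * complex_of_real (real_of_int k * (- pi))) * exp (\<i> * (of_int k * (of_real pi * 2)))"
    by (simp add: exp_add[symmetric] algebra_simps del: exp_2pi_1_int)
  then have F: "?F pi - ?F (- pi) = 0"
    by simp
  have "has_bochner_integral lborel
    (\<lambda>t. indicator {- pi..pi} t *\<^sub>R exp (\<i> * complex_of_real (real_of_int k * t))) (?F pi - ?F (- pi))"
    by (rule has_bochner_integral_FTC_Icc[OF _ deriv]) (auto intro!: continuous_intros)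
  with F False show ?thesis by simp
qed

text \<open>
  Lebesgue measure on the cube is a product measure, so the integral factors into integrals over the
  circle, and the factor of a coordinate in which \<open>x\<close> does not vanish is \<open>0\<close>.
\<close>

lemma integral_lattice_char:
  fixes x :: "int ^ 'd"
  shows "(\<integral>\<xi>. lattice_char x \<xi> \<partial>cube_measure)
    = (if x = 0 then complex_of_real ((2 * pi) ^ CARD('d)) else 0)"
proof -
  interpret product_sigma_finite "\<lambda>b :: real ^ 'd. lborel :: real measure" ..
  \<comment> \<open>\<open>k\<close> is the coordinate of \<open>x\<close> in the direction of a basis vector, as a function of the basis vector.\<close>
  define k where "k b = (\<Sum>i\<in>UNIV. if b = axis i 1 then x $ i else 0)" for b :: "real ^ 'd"
  have k_axis: "k (axis i 1) = x $ i" for i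
    by (simp add: k_def axis_eq_axis)
  have k: "real_vec x \<bullet> b = of_int (k b)" if b: "b \<in> Basis" for b
  proof -
    obtain i where "b = axis i 1" using b by (auto simp: Basis_vec_def)
    then show ?thesis by (simp add: k_axis inner_axis real_vec_def)
  qed
  let ?g = "\<lambda>b t. indicator {- pi..pi} t *\<^sub>R exp (\<i> * complex_of_real (real_of_int (k b) * t))"
  let ?emb = "\<lambda>f. \<Sum>b\<in>Basis. f b *\<^sub>R b :: real ^ 'd"
  have emb: "?emb f \<bullet> b = f b" if "b \<in> Basis" for f and b :: "real ^ 'd"
    using that by (rule inner_sum_left_Basis)
  have pt: "indicator cube (?emb f) *\<^sub>R lattice_char x (?emb f) = (\<Prod>b\<in>Basis. ?g b (f b))" for f
  proof (cases "\<forall>b\<in>Basis. f b \<in> {- pi..pi}")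
    case True
    then have "?emb f \<in> cube"
      using emb[of _ f] by (auto simp: mem_cube cart_eq_inner_axis)
    have "real_vec x \<bullet> ?emb f = (\<Sum>b\<in>Basis. of_int (k b) * f b)"
      by (simp add: inner_sum_right k mult.commute cong: sum.cong)
    then show ?thesis
      using True \<open>?emb f \<in> cube\<close> by (simp add: lattice_char_def exp_sum sum_distrib_left)
  next
    case False
    then obtain b where b: "b \<in> Basis" "f b \<notin> {- pi..pi}" by blast
    then obtain i where "b = axis i 1" by (auto simp: Basis_vec_def)
    then have "?emb f $ i = f b"
      using emb[OF b(1), of f] by (simp add: cart_eq_inner_axis)
    then have "\<not> (- pi \<le> ?emb f $ i \<and> ?emb f $ i \<le> pi)" using b(2) by (simp only: atLeastAtMost_iff) simp
    then have "?emb f \<notin> cube" unfolding mem_cube by blast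
    moreover have "(\<Prod>b\<in>Basis. ?g b (f b)) = 0"
    proof (rule prod_zero)
      show "\<exists>b\<in>Basis. ?g b (f b) = 0"
        using b by (intro bexI[of _ b]) (simp_all add: indicator_def)
    qed simp
    ultimately show ?thesis by simp
  qed
  have meas: "lattice_char x \<in> borel_measurable borel"
    by (intro borel_measurable_continuous_onI continuous_intros)
  have "(\<integral>\<xi>. lattice_char x \<xi> \<partial>cube_measure) = (\<integral>\<xi>. indicator cube \<xi> *\<^sub>R lattice_char x \<xi> \<partial>lborel)"
    by (rule integral_cube_measure)
  also have "\<dots> = (\<integral>f. indicator cube (?emb f) *\<^sub>R lattice_char x (?emb f) \<partial>(\<Pi>\<^sub>M b\<in>Basis. lborel))"
    by (subst lborel_eq, subst integral_distr)
       (auto intro!: borel_measurable_scaleR borel_measurable_indicator meas)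
  also have "\<dots> = (\<Prod>b\<in>Basis. integral\<^sup>L lborel (?g b))"
    unfolding pt
  proof (rule product_integral_prod)
    show "integrable lborel (?g b)" for b
      by (rule integrable.intros[OF integral_circle_char])
  qed simp
  also have "\<dots> = (\<Prod>b\<in>Basis. if k b = 0 then complex_of_real (2 * pi) else 0)"
    by (intro prod.cong refl has_bochner_integral_integral_eq integral_circle_char)
  also have "\<dots> = (if x = 0 then complex_of_real ((2 * pi) ^ CARD('d)) else 0)"
  proof (cases "x = 0")
    case True
    then have "k b = 0" for b by (auto simp: k_def intro!: sum.neutral)
    with True show ?thesis by simp
  next
    case False
    then obtain i where "x $ i \<noteq> 0" by (auto simp: vec_eq_iff)
    then show ?thesis
      using False by (auto intro!: prod_zero bexI[of _ "axis i 1"] simp: k_axis)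
  qed
  finally show ?thesis .
qed

lemma lattice_char_orthogonal:
  fixes x y :: "int ^ 'd"
  shows "(\<integral>\<xi>. lattice_char x \<xi> * cnj (lattice_char y \<xi>) \<partial>cube_measure)
    = (if x = y then complex_of_real ((2 * pi) ^ CARD('d)) else 0)"
proof -
  have "lattice_char x \<xi> * cnj (lattice_char y \<xi>) = lattice_char (x - y) \<xi>" for \<xi>
    using lattice_char_add_left[of x "- y" \<xi>] by (simp add: lattice_char_minus_left cnj_lattice_char)
  then show ?thesis by (simp add: integral_lattice_char)
qed

lemma fourier_inversion:
  fixes a :: "int ^ 'd \<Rightarrow> complex"
  assumes a: "l1 a"
  shows "(\<integral>\<xi>. fourier a \<xi> * cnj (lattice_char y \<xi>) \<partial>cube_measure)
    = complex_of_real ((2 * pi) ^ CARD('d)) * a y"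
proof -
  let ?g = "\<lambda>x \<xi>. lattice_char x \<xi> * cnj (lattice_char y \<xi>)"
  have eq: "(\<Sum>\<^sub>\<infinity>x. a x * ?g x \<xi>) = fourier a \<xi> * cnj (lattice_char y \<xi>)" for \<xi>
    by (simp only: fourier_eq mult.assoc[symmetric] infsum_cmult_left')
  have "((\<lambda>x. a x * integral\<^sup>L cube_measure (?g x)) has_sum (\<integral>\<xi>. (\<Sum>\<^sub>\<infinity>x. a x * ?g x \<xi>) \<partial>cube_measure)) UNIV"
  proof (rule has_sum_integral[OF finite_cube_measure a])
    show "(\<lambda>\<xi>. \<Sum>\<^sub>\<infinity>x. a x * ?g x \<xi>) \<in> borel_measurable cube_measure"
      unfolding eq
      by (intro measurable_cube_measureI borel_measurable_continuous_onI continuous_intros continuous_on_fourier[OF a])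
  qed (auto simp: norm_mult intro!: measurable_cube_measureI borel_measurable_continuous_onI continuous_intros)
  then have "(\<Sum>\<^sub>\<infinity>x. a x * integral\<^sup>L cube_measure (?g x)) = (\<integral>\<xi>. fourier a \<xi> * cnj (lattice_char y \<xi>) \<partial>cube_measure)"
    unfolding eq by (rule infsumI)
  moreover have "(\<Sum>\<^sub>\<infinity>x. a x * integral\<^sup>L cube_measure (?g x)) = (\<Sum>\<^sub>\<infinity>x\<in>{y}. a x * complex_of_real ((2 * pi) ^ CARD('d)))"
    by (intro infsum_cong_neutral) (auto simp: lattice_char_orthogonal)
  ultimately show ?thesis by (simp add: mult.commute)
qed

section \<open>A lower bound for the sup norm\<close>

lemma norm_le_sup_norm:
  assumes "l1 a" shows "norm (a x) \<le> sup_norm a"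
proof -
  have "norm (a y) \<le> (\<Sum>\<^sub>\<infinity>x. norm (a x))" for y
    using finite_sum_le_infsum[OF assms, of "{y}"] by simp
  then have "bdd_above (range (\<lambda>x. norm (a x)))"
    by (intro bdd_aboveI2)
  then show ?thesis unfolding sup_norm_def by (rule cSUP_upper[OF UNIV_I])
qed

text \<open>
  Test \<open>\<psi>\<close> against the kernel \<open>x \<mapsto> exp(i x \<bullet> z) |S(x)|\<^sup>2\<close>, where \<open>S(x)\<close> is the integral of \<open>w\<close> times the
  character of \<open>x\<close> over \<open>A\<close>. By Bessel's inequality the kernel has \<open>\<ell>\<^sup>1\<close>-norm at most \<open>(2\<pi>)\<^sup>d |A|\<close>, so the
  pairing \<open>T\<close> has modulus at most \<open>(2\<pi>)\<^sup>d |A|\<close> times the sup norm of \<open>\<psi>\<close>. Expanding both factors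
  \<open>S(x)\<close> and its conjugate turns \<open>T\<close> into a double integral over \<open>A \<times> A\<close> of the function in the last
  hypothesis, up to the constant phase \<open>\<kappa>\<close>; hence \<open>|T| \<ge> |A|\<^sup>2 / 2\<close>.
\<close>

lemma sup_norm_lower_bound:
  fixes \<psi> :: "int ^ 'd \<Rightarrow> complex" and A :: "(real ^ 'd) set"
  assumes \<psi>: "l1 \<psi>"
    and A: "A \<in> sets borel" "A \<subseteq> cube"
    and w: "continuous_on UNIV w" "\<And>\<eta>. norm (w \<eta>) = 1"
    and \<kappa>: "norm \<kappa> = 1"
    and lower: "\<And>\<eta> \<eta>'. \<eta> \<in> A \<Longrightarrow> \<eta>' \<in> A \<Longrightarrow>
      1 / 2 \<le> Re (\<kappa> * w \<eta> * cnj (w \<eta>') * fourier \<psi> (z + \<eta> - \<eta>'))"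
  shows "measure lborel A \<le> 2 * (2 * pi) ^ CARD('d) * sup_norm \<psi>"
proof -
  interpret finite_measure "cube_measure :: (real ^ 'd) measure" by (rule finite_cube_measure)
  let ?M = "cube_measure :: (real ^ 'd) measure"
  define c where "c = (2 * pi) ^ CARD('d)"
  have c: "0 < c" by (simp add: c_def)
  define f where "f \<eta> = indicator A \<eta> * w \<eta>" for \<eta>
  have f_meas: "f \<in> borel_measurable ?M"
    unfolding f_def using A w(1)
    by (intro measurable_cube_measureI borel_measurable_times borel_measurable_indicator
        borel_measurable_continuous_onI) auto
  have f_norm: "norm (f \<eta>) = indicator A \<eta>" for \<eta>
    by (simp add: f_def norm_mult w(2) indicator_def)
  have char_meas: "lattice_char x \<in> borel_measurable ?M" for x
    by (intro measurable_cube_measureI borel_measurable_continuous_onI continuous_intros)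
  have meas_A: "measure ?M A = measure lborel A"
    using A unfolding cube_measure_def by (subst measure_restrict_space) auto
  have A_sets: "A \<in> sets ?M"
    using A by (auto simp: cube_measure_def sets_restrict_space image_iff intro!: bexI[of _ A])
  define S where "S x = (\<integral>\<eta>. f \<eta> * lattice_char x \<eta> \<partial>?M)" for x
  have bessel: "(\<Sum>x\<in>X. (norm (S x))\<^sup>2) \<le> c * measure lborel A" if "finite X" for X
  proof -
    have "(\<Sum>x\<in>X. (norm (S x))\<^sup>2) \<le> c * (\<integral>\<eta>. (norm (f \<eta>))\<^sup>2 \<partial>?M)"
      unfolding S_def c_def
      by (rule bessel_inequality[OF finite_cube_measure _ f_meas _ char_meas])
         (auto simp: f_norm lattice_char_orthogonal that indicator_def)
    also have "(\<integral>\<eta>. (norm (f \<eta>))\<^sup>2 \<partial>?M) = (\<integral>\<eta>. indicator A \<eta> \<partial>?M)"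
      by (intro Bochner_Integration.integral_cong) (auto simp: f_norm indicator_def)
    also have "\<dots> = measure lborel A"
      using A_sets A(2) by (simp add: meas_A Int_absorb2)
    finally show ?thesis .
  qed
  \<comment> \<open>Only one of the two factors \<open>S x\<close> is absorbed here, so that each exchange of sum and integral
    involves a single integral.\<close>
  define a where "a x = \<psi> x * lattice_char x z * cnj (S x)" for x
  have a: "l1 a"
  proof (rule Infinite_Sum.abs_summable_on_comparison_test)
    show "l1 (\<lambda>x. complex_of_real (sqrt (c * measure lborel A)) * \<psi> x)"
      unfolding norm_mult by (intro summable_on_cmult_right \<psi>)
    fix x
    have "norm (S x) \<le> sqrt (c * measure lborel A)"
      using bessel[of "{x}"] by (intro real_le_rsqrt) simp
    then have "norm (S x) * norm (\<psi> x) \<le> sqrt (c * measure lborel A) * norm (\<psi> x)"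
      by (intro mult_right_mono) auto
    then show "norm (a x) \<le> norm (complex_of_real (sqrt (c * measure lborel A)) * \<psi> x)"
      using c by (simp add: a_def norm_mult mult.commute)
  qed
  have fourier_a: "fourier a \<eta> = (\<integral>\<eta>'. cnj (f \<eta>') * fourier \<psi> (z + \<eta> - \<eta>') \<partial>?M)" for \<eta>
  proof -
    let ?b = "\<lambda>x. \<psi> x * lattice_char x z * lattice_char x \<eta>"
    let ?g = "\<lambda>x \<eta>'. cnj (f \<eta>' * lattice_char x \<eta>')"
    have eq: "(\<Sum>\<^sub>\<infinity>x. ?b x * ?g x \<eta>') = cnj (f \<eta>') * fourier \<psi> (z + \<eta> - \<eta>')" for \<eta>'
    proof -
      have "?b x * ?g x \<eta>' = cnj (f \<eta>') * (\<psi> x * lattice_char x (z + \<eta> - \<eta>'))" for x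
        using lattice_char_add[of x "z + \<eta>" "- \<eta>'"]
        by (simp add: lattice_char_add cnj_lattice_char)
      then show ?thesis by (simp only: fourier_eq infsum_cmult_right')
    qed
    have "((\<lambda>x. ?b x * integral\<^sup>L ?M (?g x)) has_sum (\<integral>\<eta>'. (\<Sum>\<^sub>\<infinity>x. ?b x * ?g x \<eta>') \<partial>?M)) UNIV"
    proof (rule has_sum_integral[OF finite_cube_measure])
      show "l1 ?b" using \<psi> by (simp add: norm_mult)
      show "?g x \<in> borel_measurable ?M" for x
        by (intro borel_measurable_cnj borel_measurable_times f_meas char_meas)
      show "(\<lambda>\<eta>'. \<Sum>\<^sub>\<infinity>x. ?b x * ?g x \<eta>') \<in> borel_measurable ?M"
        unfolding eq
        by (intro borel_measurable_times borel_measurable_cnj f_meas measurable_cube_measureI borel_measurable_continuous_onI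
            continuous_on_compose2[OF continuous_on_fourier[OF \<psi>]] continuous_intros) auto
    qed (auto simp: norm_mult f_norm indicator_def)
    moreover have "integral\<^sup>L ?M (?g x) = cnj (S x)" for x
      unfolding S_def by (simp del: complex_cnj_mult)
    ultimately show ?thesis
      unfolding eq by (simp add: fourier_eq a_def infsumI mult_ac)
  qed
  define T where "T = (\<integral>\<eta>. f \<eta> * fourier a \<eta> \<partial>?M)"
  have T_sum: "((\<lambda>x. a x * S x) has_sum T) UNIV"
  proof -
    have eq: "(\<Sum>\<^sub>\<infinity>x. a x * (f \<eta> * lattice_char x \<eta>)) = f \<eta> * fourier a \<eta>" for \<eta>
    proof -
      have "a x * (f \<eta> * lattice_char x \<eta>) = f \<eta> * (a x * lattice_char x \<eta>)" for x
        by (rule mult.left_commute)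
      then show ?thesis by (simp only: fourier_eq infsum_cmult_right')
    qed
    have "((\<lambda>x. a x * (\<integral>\<eta>. f \<eta> * lattice_char x \<eta> \<partial>?M)) has_sum
        (\<integral>\<eta>. (\<Sum>\<^sub>\<infinity>x. a x * (f \<eta> * lattice_char x \<eta>)) \<partial>?M)) UNIV"
    proof (rule has_sum_integral[OF finite_cube_measure a])
      show "(\<lambda>\<eta>. \<Sum>\<^sub>\<infinity>x. a x * (f \<eta> * lattice_char x \<eta>)) \<in> borel_measurable ?M"
        unfolding eq
        by (intro borel_measurable_times f_meas measurable_cube_measureI borel_measurable_continuous_onI
            continuous_on_fourier[OF a])
    qed (auto simp: norm_mult f_norm indicator_def intro!: borel_measurable_times f_meas char_meas)
    then show ?thesis unfolding eq S_def T_def .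
  qed
  have "norm T \<le> sup_norm \<psi> * (c * measure lborel A)"
  proof (rule Lim_norm_ubound)
    show "((\<lambda>X. \<Sum>x\<in>X. a x * S x) \<longlongrightarrow> T) (finite_subsets_at_top UNIV)"
      using T_sum by (simp add: has_sum_def)
    have "norm (\<Sum>x\<in>X. a x * S x) \<le> sup_norm \<psi> * (c * measure lborel A)" if "finite X" for X
    proof -
      have "norm (\<Sum>x\<in>X. a x * S x) \<le> (\<Sum>x\<in>X. sup_norm \<psi> * (norm (S x))\<^sup>2)"
        by (rule sum_norm_le)
           (auto simp: a_def norm_mult power2_eq_square mult.assoc intro!: mult_right_mono norm_le_sup_norm[OF \<psi>])
      also have "\<dots> = sup_norm \<psi> * (\<Sum>x\<in>X. (norm (S x))\<^sup>2)"
        by (simp add: sum_distrib_left)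
      also have "\<dots> \<le> sup_norm \<psi> * (c * measure lborel A)"
        using order_trans[OF norm_ge_zero norm_le_sup_norm[OF \<psi>]]
        by (intro mult_left_mono bessel that)
      finally show ?thesis .
    qed
    then show "eventually (\<lambda>X. norm (\<Sum>x\<in>X. a x * S x) \<le> sup_norm \<psi> * (c * measure lborel A))
        (finite_subsets_at_top UNIV)"
      by (simp add: eventually_finite_subsets_at_top) blast
  qed simp
  moreover have "measure lborel A * measure lborel A / 2 \<le> norm T"
  proof -
    have bound_int: "integrable ?M h" if "h \<in> borel_measurable ?M" "\<And>\<eta>. norm (h \<eta>) \<le> C"
      for h :: "real ^ 'd \<Rightarrow> complex" and C
      using that by (intro integrable_const_bound[of _ C]) auto
    have const_int: "integrable ?M (\<lambda>\<eta>. C * indicator A \<eta> :: real)"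
      "(\<integral>\<eta>. C * indicator A \<eta> \<partial>?M) = C * measure lborel A" for C
      using A_sets A(2) by (simp_all add: meas_A Int_absorb2 emeasure_eq_measure)
    have Re_ge: "C * measure lborel A \<le> Re (integral\<^sup>L ?M h)"
      if h: "integrable ?M h" and ge: "\<And>\<eta>. C * indicator A \<eta> \<le> Re (h \<eta>)"
      for h :: "real ^ 'd \<Rightarrow> complex" and C
    proof -
      have "C * measure lborel A = (\<integral>\<eta>. C * indicator A \<eta> \<partial>?M)" by (rule const_int(2)[symmetric])
      also have "\<dots> \<le> (\<integral>\<eta>. Re (h \<eta>) \<partial>?M)"
        by (intro integral_mono const_int(1) integrable_Re h ge)
      also have "\<dots> = Re (integral\<^sup>L ?M h)" using h by simp
      finally show ?thesis .
    qed
    have inner: "measure lborel A / 2 \<le> Re (\<kappa> * (f \<eta> * fourier a \<eta>))" if \<eta>: "\<eta> \<in> A" for \<eta>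
    proof -
      let ?h = "\<lambda>\<eta>'. cnj (f \<eta>') * fourier \<psi> (z + \<eta> - \<eta>')"
      have h: "integrable ?M ?h"
      proof (rule bound_int)
        show "?h \<in> borel_measurable ?M"
          by (intro borel_measurable_times borel_measurable_cnj f_meas measurable_cube_measureI borel_measurable_continuous_onI
            continuous_on_compose2[OF continuous_on_fourier[OF \<psi>]] continuous_intros) auto
        show "norm (?h \<eta>') \<le> (\<Sum>\<^sub>\<infinity>x. norm (\<psi> x))" for \<eta>'
          using norm_fourier_le[OF \<psi>, of "z + \<eta> - \<eta>'"] infsum_nonneg[of UNIV "\<lambda>x. norm (\<psi> x)"]
          by (simp add: norm_mult f_norm indicator_def)
      qed
      have "(1 / 2) * measure lborel A \<le> Re (\<integral>\<eta>'. \<kappa> * f \<eta> * ?h \<eta>' \<partial>?M)"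
      proof (rule Re_ge)
        show "integrable ?M (\<lambda>\<eta>'. \<kappa> * f \<eta> * ?h \<eta>')" using h by simp
        show "1 / 2 * indicator A \<eta>' \<le> Re (\<kappa> * f \<eta> * ?h \<eta>')" for \<eta>'
          using lower[OF \<eta>, of \<eta>'] \<eta> by (auto simp: f_def indicator_def mult.assoc)
      qed
      also have "(\<integral>\<eta>'. \<kappa> * f \<eta> * ?h \<eta>' \<partial>?M) = \<kappa> * (f \<eta> * fourier a \<eta>)"
        by (simp add: fourier_a mult.assoc)
      finally show ?thesis by simp
    qed
    have int: "integrable ?M (\<lambda>\<eta>. f \<eta> * fourier a \<eta>)"
    proof (rule bound_int)
      show "(\<lambda>\<eta>. f \<eta> * fourier a \<eta>) \<in> borel_measurable ?M"
        by (intro borel_measurable_times f_meas measurable_cube_measureI borel_measurable_continuous_onI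
            continuous_on_fourier[OF a])
      show "norm (f \<eta> * fourier a \<eta>) \<le> (\<Sum>\<^sub>\<infinity>x. norm (a x))" for \<eta>
        using norm_fourier_le[OF a, of \<eta>] infsum_nonneg[of UNIV "\<lambda>x. norm (a x)"]
        by (simp add: norm_mult f_norm indicator_def)
    qed
    have "(measure lborel A / 2) * measure lborel A \<le> Re (\<integral>\<eta>. \<kappa> * (f \<eta> * fourier a \<eta>) \<partial>?M)"
    proof (rule Re_ge)
      show "integrable ?M (\<lambda>\<eta>. \<kappa> * (f \<eta> * fourier a \<eta>))" using int by simp
      show "measure lborel A / 2 * indicator A \<eta> \<le> Re (\<kappa> * (f \<eta> * fourier a \<eta>))" for \<eta>
        using inner[of \<eta>] by (cases "\<eta> \<in> A") (auto simp: f_def)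
    qed
    also have "\<dots> = Re (\<kappa> * T)" by (simp add: T_def)
    also have "\<dots> \<le> norm T"
      using complex_Re_le_cmod[of "\<kappa> * T"] \<kappa> by (simp add: norm_mult)
    finally show ?thesis by (simp add: mult.commute)
  qed
  ultimately have "measure lborel A * measure lborel A \<le> measure lborel A * (2 * c * sup_norm \<psi>)"
    by (simp add: algebra_simps)
  moreover have "0 \<le> 2 * c * sup_norm \<psi>"
    using order_trans[OF norm_ge_zero norm_le_sup_norm[OF \<psi>]] c by simp
  ultimately show ?thesis
    unfolding c_def by (cases "measure lborel A = 0") (auto simp: mult_le_cancel_left_pos zero_less_measure_iff)
qed

section \<open>Estimates near the maxima of the Fourier transform\<close>

lemma homogeneous_function_Re:
  assumes "positive_homogeneous P" "E \<in> Exp_set P"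
  shows "homogeneous_function (\<lambda>\<xi>. Re (P \<xi>)) E"
proof
  show "continuous_on UNIV (\<lambda>\<xi>. Re (P \<xi>))"
    using assms(1) by (auto simp: positive_homogeneous_def intro: continuous_on_Re)
  show "Re (P (real_powm t E *v \<xi>)) = t * Re (P \<xi>)" if "0 < t" for t \<xi>
  proof -
    have "P (real_powm t E *v \<xi>) = complex_of_real t * P \<xi>"
      using assms(2) that by (simp add: Exp_set_def)
    then show ?thesis by simp
  qed
qed (use assms(1) in \<open>auto simp: positive_homogeneous_def\<close>)

text \<open>
  All estimates below are carried out with the exponent that \<^const>\<open>mu_poly\<close> selects.
\<close>

lemma mu_poly_exponent:
  assumes "positive_homogeneous P"
  obtains E where "E \<in> Exp_set P" "mu_poly P = trace E"
proof
  show "(SOME E. E \<in> Exp_set P) \<in> Exp_set P"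
    using assms by (auto simp: positive_homogeneous_def intro: someI)
qed (simp add: mu_poly_def)

text \<open>
  Near \<open>z\<close> the expansion is used in exponentiated form, with \<open>L\<close> the logarithm of the ratio and
  with the remainder already bounded by half of \<open>Re P\<close>. The point \<open>\<xi> = 0\<close>, at which the
  \<open>o\<close>-condition says nothing, is included: there \<open>L = 0\<close>.
\<close>

lemma expansion_exp_form:
  fixes \<phi> :: "int ^ 'd \<Rightarrow> complex"
  assumes \<phi>: "l1 \<phi>" and z: "norm (fourier \<phi> z) = 1" and ex: "has_pos_hom_expansion \<phi> z \<alpha> P"
  obtains \<delta> where "0 < \<delta>"
    "\<And>\<xi>. norm \<xi> < \<delta> \<Longrightarrow> \<exists>L. fourier \<phi> (\<xi> + z) = fourier \<phi> z * exp L \<and>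
       norm (L - (\<i> * complex_of_real (\<alpha> \<bullet> \<xi>) - P \<xi>)) \<le> Re (P \<xi>) / 2"
proof -
  have P: "positive_homogeneous P"
    using ex by (simp add: has_pos_hom_expansion_def pos_hom_polynomial_def)
  then obtain E where E: "E \<in> Exp_set P" by (rule mu_poly_exponent)
  interpret homogeneous_function "\<lambda>\<xi>. Re (P \<xi>)" E by (rule homogeneous_function_Re[OF P E])
  have P0: "P 0 = 0"
  proof -
    have "complex_of_real 2 * P 0 = P (real_powm 2 E *v 0)"
      using E unfolding Exp_set_def by (metis (mono_tags, lifting) mem_Collect_eq zero_less_numeral)
    then show ?thesis by simp
  qed
  have nz: "fourier \<phi> z \<noteq> 0" using z by auto
  have "eventually (\<lambda>\<xi>. norm (log_ratio \<phi> z \<xi> - (\<i> * complex_of_real (\<alpha> \<bullet> \<xi>) - P \<xi>))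
      \<le> (1 / 2) * norm (complex_of_real (Re (P \<xi>)))) (at 0)"
    using ex by (intro landau_o.smallD) (auto simp: has_pos_hom_expansion_def)
  moreover have "eventually (\<lambda>\<xi>. fourier \<phi> (\<xi> + z) \<noteq> 0) (at 0)"
  proof -
    have "isCont (\<lambda>\<xi>. fourier \<phi> (\<xi> + z)) 0"
      using continuous_on_compose2[OF continuous_on_fourier[OF \<phi>], of UNIV "\<lambda>\<xi>. \<xi> + z"]
      by (auto simp: continuous_on_eq_continuous_at intro!: continuous_intros)
    then have "((\<lambda>\<xi>. fourier \<phi> (\<xi> + z)) \<longlongrightarrow> fourier \<phi> z) (at 0)"
      by (simp add: isCont_def)
    then show ?thesis using nz by (rule tendsto_imp_eventually_ne)
  qed
  ultimately have "eventually (\<lambda>\<xi>. \<exists>L. fourier \<phi> (\<xi> + z) = fourier \<phi> z * exp L \<and>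
       norm (L - (\<i> * complex_of_real (\<alpha> \<bullet> \<xi>) - P \<xi>)) \<le> Re (P \<xi>) / 2) (at 0)"
  proof eventually_elim
    case (elim \<xi>)
    then show ?case
      using nz nonneg[of \<xi>] by (intro exI[of _ "log_ratio \<phi> z \<xi>"]) (simp add: log_ratio_def)
  qed
  then obtain \<delta> where \<delta>: "0 < \<delta>" "\<And>\<xi>. \<xi> \<noteq> 0 \<Longrightarrow> norm \<xi> < \<delta> \<Longrightarrow> \<exists>L. fourier \<phi> (\<xi> + z) = fourier \<phi> z * exp L \<and>
       norm (L - (\<i> * complex_of_real (\<alpha> \<bullet> \<xi>) - P \<xi>)) \<le> Re (P \<xi>) / 2"
    unfolding eventually_at by auto
  have "\<exists>L. fourier \<phi> (0 + z) = fourier \<phi> z * exp L \<and>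
       norm (L - (\<i> * complex_of_real (\<alpha> \<bullet> 0) - P 0)) \<le> Re (P 0) / 2"
    by (rule exI[of _ 0]) (simp add: P0)
  with \<delta> show ?thesis by (intro that[of \<delta>]) metis+
qed

lemma norm_fourier_near_maximum:
  assumes "l1 \<phi>" "norm (fourier \<phi> z) = 1" "has_pos_hom_expansion \<phi> z \<alpha> P"
  obtains \<delta> where "0 < \<delta>" "\<And>\<xi>. norm \<xi> < \<delta> \<Longrightarrow> norm (fourier \<phi> (\<xi> + z)) \<le> exp (- (Re (P \<xi>) / 2))"
proof -
  obtain \<delta> where \<delta>: "0 < \<delta>" "\<And>\<xi>. norm \<xi> < \<delta> \<Longrightarrow> \<exists>L. fourier \<phi> (\<xi> + z) = fourier \<phi> z * exp L \<and>
       norm (L - (\<i> * complex_of_real (\<alpha> \<bullet> \<xi>) - P \<xi>)) \<le> Re (P \<xi>) / 2"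
    using expansion_exp_form[OF assms] by blast
  have "norm (fourier \<phi> (\<xi> + z)) \<le> exp (- (Re (P \<xi>) / 2))" if "norm \<xi> < \<delta>" for \<xi>
  proof -
    obtain L where L: "fourier \<phi> (\<xi> + z) = fourier \<phi> z * exp L"
       "norm (L - (\<i> * complex_of_real (\<alpha> \<bullet> \<xi>) - P \<xi>)) \<le> Re (P \<xi>) / 2"
      using \<delta>(2)[OF \<open>norm \<xi> < \<delta>\<close>] by blast
    have "Re L + Re (P \<xi>) \<le> Re (P \<xi>) / 2"
      using complex_Re_le_cmod[of "L - (\<i> * complex_of_real (\<alpha> \<bullet> \<xi>) - P \<xi>)"] L(2) by simp
    then show ?thesis by (simp add: L(1) norm_mult assms(2))
  qed
  with \<delta>(1) show ?thesis by (rule that)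
qed

text \<open>
  The upper bound \<open>exp(- Re P / 2)\<close> is strictly less than \<open>1\<close> away from the maximum, by positive
  definiteness.
\<close>

lemma maximum_isolated:
  assumes "l1 \<phi>" "norm (fourier \<phi> z) = 1" "has_pos_hom_expansion \<phi> z \<alpha> P"
  obtains \<delta> where "0 < \<delta>" "\<And>\<xi>. \<xi> \<in> ball z \<delta> \<Longrightarrow> norm (fourier \<phi> \<xi>) = 1 \<Longrightarrow> \<xi> = z"
proof -
  obtain \<delta> where \<delta>: "0 < \<delta>" "\<And>\<xi>. norm \<xi> < \<delta> \<Longrightarrow> norm (fourier \<phi> (\<xi> + z)) \<le> exp (- (Re (P \<xi>) / 2))"
    using norm_fourier_near_maximum[OF assms] by blast
  have "\<xi> = z" if "\<xi> \<in> ball z \<delta>" "norm (fourier \<phi> \<xi>) = 1" for \<xi>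
  proof -
    have "Re (P (\<xi> - z)) \<le> 0"
      using \<delta>(2)[of "\<xi> - z"] that by (simp add: dist_norm norm_minus_commute)
    moreover have "positive_homogeneous P"
      using assms(3) by (simp add: has_pos_hom_expansion_def pos_hom_polynomial_def)
    ultimately have "\<xi> - z = 0"
      unfolding positive_homogeneous_def by (meson order_antisym)
    then show ?thesis by simp
  qed
  with \<delta>(1) show ?thesis by (rule that)
qed

lemma local_upper_bound:
  fixes \<phi> :: "int ^ 'd \<Rightarrow> complex"
  assumes "l1 \<phi>" "norm (fourier \<phi> z) = 1" "has_pos_hom_expansion \<phi> z \<alpha> P"
  shows "\<exists>U C. open U \<and> z \<in> U \<and> 0 < C \<and> (\<forall>n\<ge>1.
    (\<integral>\<^sup>+\<xi>. ennreal (norm (fourier \<phi> \<xi>) ^ n) * indicator U \<xi> \<partial>lborel) \<le> ennreal (C * real n powr (- mu_poly P)))"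
proof -
  have P: "positive_homogeneous P"
    using assms(3) by (simp add: has_pos_hom_expansion_def pos_hom_polynomial_def)
  then obtain E where E: "E \<in> Exp_set P" "mu_poly P = trace E" by (rule mu_poly_exponent)
  interpret homogeneous_function "\<lambda>\<xi>. Re (P \<xi>)" E by (rule homogeneous_function_Re[OF P E(1)])
  obtain C where C: "0 < C" "\<And>n. n \<ge> 1 \<Longrightarrow> (\<integral>\<^sup>+ \<xi>. ennreal (exp (- (1 / 2 * real n * Re (P \<xi>)))) \<partial>lborel)
      \<le> ennreal (C * real n powr (- trace E))"
    using nn_integral_exp_le[of "1 / 2"] by auto
  obtain \<delta> where \<delta>: "0 < \<delta>" "\<And>\<xi>. norm \<xi> < \<delta> \<Longrightarrow> norm (fourier \<phi> (\<xi> + z)) \<le> exp (- (Re (P \<xi>) / 2))"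
    using norm_fourier_near_maximum[OF assms] by blast
  have "(\<integral>\<^sup>+\<xi>. ennreal (norm (fourier \<phi> \<xi>) ^ n) * indicator (ball z \<delta>) \<xi> \<partial>lborel)
      \<le> ennreal (C * real n powr (- mu_poly P))" if n: "n \<ge> 1" for n
  proof -
    let ?h = "\<lambda>\<xi>. ennreal (exp (- (1 / 2 * real n * Re (P \<xi>))))"
    have h: "?h \<in> borel_measurable borel"
      by (intro measurable_compose[OF _ measurable_ennreal] borel_measurable_continuous_onI continuous_intros cont)
    have "(\<integral>\<^sup>+\<xi>. ennreal (norm (fourier \<phi> \<xi>) ^ n) * indicator (ball z \<delta>) \<xi> \<partial>lborel)
        \<le> (\<integral>\<^sup>+\<xi>. ?h (- z + \<xi>) \<partial>lborel)"
    proof (rule nn_integral_mono)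
      fix \<xi> :: "real ^ 'd"
      show "ennreal (norm (fourier \<phi> \<xi>) ^ n) * indicator (ball z \<delta>) \<xi> \<le> ?h (- z + \<xi>)"
      proof (cases "\<xi> \<in> ball z \<delta>")
        case True
        then have "norm (fourier \<phi> \<xi>) \<le> exp (- (Re (P (- z + \<xi>)) / 2))"
          using \<delta>(2)[of "- z + \<xi>"] by (simp add: dist_norm norm_minus_commute)
        then have "norm (fourier \<phi> \<xi>) ^ n \<le> exp (- (Re (P (- z + \<xi>)) / 2)) ^ n"
          by (intro power_mono) auto
        also have "\<dots> = exp (- (1 / 2 * real n * Re (P (- z + \<xi>))))"
          by (simp add: exp_of_nat_mult[symmetric])
        finally show ?thesis using True by (simp add: ennreal_leI)
      qed simp
    qed
    also have "\<dots> = (\<integral>\<^sup>+\<xi>. ?h \<xi> \<partial>distr lborel borel ((+) (- z)))"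
      by (subst nn_integral_distr) (use h in auto)
    also have "\<dots> = (\<integral>\<^sup>+\<xi>. ?h \<xi> \<partial>lborel)"
      by (simp only: lborel_distr_plus)
    also have "\<dots> \<le> ennreal (C * real n powr (- mu_poly P))"
      using C(2)[OF n] by (simp add: E(2))
    finally show ?thesis .
  qed
  then show ?thesis
    using \<delta>(1) C(1) by (intro exI[of _ "ball z \<delta>"] exI[of _ C]) auto
qed

lemma geometric_powr_bounded:
  assumes "0 < r" "r < (1 :: real)"
  obtains K where "0 < K" "\<And>n. n \<ge> 1 \<Longrightarrow> r ^ n \<le> K * real n powr (- \<nu>)"
proof -
  have "(\<lambda>n. r ^ n * real n powr \<nu>) \<longlonglongrightarrow> 0"
    using assms by real_asymp
  then have "Bseq (\<lambda>n. r ^ n * real n powr \<nu>)"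
    by (intro convergent_imp_Bseq convergentI)
  then obtain K where K: "0 < K" "\<And>n. norm (r ^ n * real n powr \<nu>) \<le> K"
    by (auto simp: Bseq_def)
  show ?thesis
  proof (rule that[OF K(1)])
    fix n :: nat assume "n \<ge> 1"
    then show "r ^ n \<le> K * real n powr (- \<nu>)"
      using K(2)[of n] assms by (simp add: powr_minus field_simps)
  qed
qed

text \<open>
  Every point of \<open>K\<close> has a neighbourhood on which the integral of \<open>|F|\<^sup>n\<close> is at most a multiple of
  \<open>n\<close> to the power \<open>- \<nu>\<close>: at the maxima by hypothesis, elsewhere since \<open>|F|\<close> is there bounded by some
  \<open>r < 1\<close> on a set of finite volume. Finitely many of these cover \<open>K\<close>.
\<close>

lemma nn_integral_power_le:
  fixes F :: "real ^ 'd \<Rightarrow> complex"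
  assumes K: "compact K"
    and F: "continuous_on UNIV F" "\<And>\<xi>. norm (F \<xi>) \<le> 1"
    and loc: "\<And>z. z \<in> K \<Longrightarrow> norm (F z) = 1 \<Longrightarrow> \<exists>U C. open U \<and> z \<in> U \<and> 0 < C \<and> (\<forall>n\<ge>1.
      (\<integral>\<^sup>+\<xi>. ennreal (norm (F \<xi>) ^ n) * indicator U \<xi> \<partial>lborel) \<le> ennreal (C * real n powr (- \<nu>)))"
  shows "\<exists>C>0. \<forall>n\<ge>1.
    (\<integral>\<^sup>+\<xi>. ennreal (norm (F \<xi>) ^ n) * indicator K \<xi> \<partial>lborel) \<le> ennreal (C * real n powr (- \<nu>))"
proof -
  define good where "good z U C \<longleftrightarrow> open U \<and> z \<in> U \<and> 0 < C \<and> (\<forall>n\<ge>1.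
      (\<integral>\<^sup>+\<xi>. ennreal (norm (F \<xi>) ^ n) * indicator U \<xi> \<partial>lborel) \<le> ennreal (C * real n powr (- \<nu>)))" for z U C
  have "\<exists>U C. good z U C"
    if z: "z \<in> K" for z
  proof (cases "norm (F z) = 1")
    case False
    define r where "r = (norm (F z) + 1) / 2"
    have r: "0 < r" "r < 1" "norm (F z) < r"
      using False F(2)[of z] by (auto simp: r_def add_nonneg_pos)
    obtain k where k: "0 < k" "\<And>n. n \<ge> 1 \<Longrightarrow> r ^ n \<le> k * real n powr (- \<nu>)"
      using geometric_powr_bounded[OF r(1,2)] by blast
    define U where "U = {\<xi>. norm (F \<xi>) < r} \<inter> ball z 1"
    have U: "open U" "z \<in> U"
      unfolding U_def
      by (intro open_Int open_Collect_less continuous_on_norm F(1) continuous_on_const open_ball)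
         (simp add: r(3))
    define v where "v = measure lborel U"
    have v: "emeasure lborel U = ennreal v" "0 \<le> v"
    proof -
      have "emeasure lborel U \<le> emeasure lborel (ball z 1)"
        by (intro emeasure_mono) (auto simp: U_def)
      also have "\<dots> < \<infinity>" by (rule emeasure_lborel_ball_finite)
      finally show "emeasure lborel U = ennreal v"
        unfolding v_def by (intro emeasure_eq_ennreal_measure) auto
    qed (simp add: v_def)
    have "(\<integral>\<^sup>+\<xi>. ennreal (norm (F \<xi>) ^ n) * indicator U \<xi> \<partial>lborel) \<le> ennreal (k * (v + 1) * real n powr (- \<nu>))"
      if n: "n \<ge> 1" for n
    proof -
      have "(\<integral>\<^sup>+\<xi>. ennreal (norm (F \<xi>) ^ n) * indicator U \<xi> \<partial>lborel) \<le> (\<integral>\<^sup>+\<xi>. ennreal (r ^ n) * indicator U \<xi> \<partial>lborel)"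
        by (intro nn_integral_mono) (auto simp: indicator_def U_def intro!: ennreal_leI power_mono)
      also have "\<dots> = ennreal (r ^ n) * ennreal v"
        using U(1) by (simp add: nn_integral_cmult_indicator v(1))
      also have "\<dots> = ennreal (r ^ n * v)"
        using r(1) v(2) by (simp add: ennreal_mult)
      also have "r ^ n * v \<le> k * real n powr (- \<nu>) * (v + 1)"
        using k r(1) v(2) n by (intro mult_mono) auto
      finally show ?thesis by (simp add: mult_ac ennreal_leI)
    qed
    then show ?thesis
      using U k(1) v(2) unfolding good_def by (intro exI[of _ U] exI[of _ "k * (v + 1)"]) auto
  qed (use loc z in \<open>simp add: good_def\<close>)
  then obtain U C where "\<And>z. z \<in> K \<Longrightarrow> good z (U z) (C z)"
    by metis
  then have UC: "\<And>z. z \<in> K \<Longrightarrow> open (U z)" "\<And>z. z \<in> K \<Longrightarrow> z \<in> U z" "\<And>z. z \<in> K \<Longrightarrow> 0 < C z"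
    "\<And>z n. z \<in> K \<Longrightarrow> n \<ge> 1 \<Longrightarrow>
      (\<integral>\<^sup>+\<xi>. ennreal (norm (F \<xi>) ^ n) * indicator (U z) \<xi> \<partial>lborel) \<le> ennreal (C z * real n powr (- \<nu>))"
    unfolding good_def by blast+
  obtain T where T: "T \<subseteq> K" "finite T" "K \<subseteq> (\<Union>z\<in>T. U z)"
    using UC(1,2) by (elim compactE_image[OF K, of K U]) auto
  have "(\<integral>\<^sup>+\<xi>. ennreal (norm (F \<xi>) ^ n) * indicator K \<xi> \<partial>lborel) \<le> ennreal ((sum C T + 1) * real n powr (- \<nu>))"
    if n: "n \<ge> 1" for n
  proof -
    have meas: "(\<lambda>\<xi>. ennreal (norm (F \<xi>) ^ n)) \<in> borel_measurable borel"
      by (intro measurable_compose[OF _ measurable_ennreal] borel_measurable_continuous_onI continuous_intros F(1))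
    have "(\<integral>\<^sup>+\<xi>. ennreal (norm (F \<xi>) ^ n) * indicator K \<xi> \<partial>lborel)
        \<le> (\<integral>\<^sup>+\<xi>. (\<Sum>z\<in>T. ennreal (norm (F \<xi>) ^ n) * indicator (U z) \<xi>) \<partial>lborel)"
    proof (rule nn_integral_mono)
      fix \<xi> :: "real ^ 'd"
      show "ennreal (norm (F \<xi>) ^ n) * indicator K \<xi> \<le> (\<Sum>z\<in>T. ennreal (norm (F \<xi>) ^ n) * indicator (U z) \<xi>)"
      proof (cases "\<xi> \<in> K")
        case True
        then obtain z where "z \<in> T" "\<xi> \<in> U z" using T(3) by blast
        then show ?thesis
          using member_le_sum[of z T "\<lambda>z. ennreal (norm (F \<xi>) ^ n) * indicator (U z) \<xi>"] T(2) True by simp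
      qed simp
    qed
    also have "\<dots> = (\<Sum>z\<in>T. \<integral>\<^sup>+\<xi>. ennreal (norm (F \<xi>) ^ n) * indicator (U z) \<xi> \<partial>lborel)"
      using UC(1) T(1) meas by (intro nn_integral_sum borel_measurable_times_ennreal borel_measurable_indicator) auto
    also have "\<dots> \<le> (\<Sum>z\<in>T. ennreal (C z * real n powr (- \<nu>)))"
      using T(1) n by (intro sum_mono UC(4)) auto
    also have "\<dots> = ennreal (\<Sum>z\<in>T. C z * real n powr (- \<nu>))"
      using UC(3) T(1) by (intro sum_ennreal mult_nonneg_nonneg) (auto intro: less_imp_le)
    also have "(\<Sum>z\<in>T. C z * real n powr (- \<nu>)) \<le> (sum C T + 1) * real n powr (- \<nu>)"
      by (simp add: sum_distrib_right[symmetric] mult_right_mono)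
    finally show ?thesis by (simp add: ennreal_leI)
  qed
  moreover have "0 < sum C T + 1"
    using UC(3) T(1) by (intro add_nonneg_pos sum_nonneg) (auto intro: less_imp_le)
  ultimately show ?thesis by blast
qed

lemma Re_exp_ge_half:
  assumes "norm q \<le> 1 / 4" shows "1 / 2 \<le> Re (exp q)"
proof -
  have re: "\<bar>Re q\<bar> \<le> 1 / 4" and im: "\<bar>Im q\<bar> \<le> 1 / 4"
    using abs_Re_le_cmod[of q] abs_Im_le_cmod[of q] assms by linarith+
  have "1 - (Im q)\<^sup>2 / 2 \<le> cos (Im q)"
  proof -
    have "cos (Im q) = 1 - 2 * (sin (Im q / 2))\<^sup>2"
      using cos_double_sin[of "Im q / 2"] by simp
    moreover have "(sin (Im q / 2))\<^sup>2 \<le> (Im q / 2)\<^sup>2"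
      unfolding abs_le_square_iff[symmetric] by (rule abs_sin_x_le_abs_x)
    ultimately show ?thesis by (simp add: power2_eq_square)
  qed
  moreover have "(Im q)\<^sup>2 \<le> (1 / 4)\<^sup>2"
    using im by (subst abs_le_square_iff[symmetric]) simp
  ultimately have cos: "3 / 4 \<le> cos (Im q)" by (simp add: power2_eq_square)
  have "3 / 4 \<le> exp (Re q)" using exp_ge_add_one_self[of "Re q"] re by linarith
  then have "(3 / 4) * (3 / 4) \<le> exp (Re q) * cos (Im q)"
    using cos by (intro mult_mono) auto
  then show ?thesis by (simp add: Re_exp)
qed

text \<open>
  \<open>sup_norm_lower_bound\<close> is applied to \<open>A = n\<^sup>-\<^sup>E B\<close>. A difference of two points of \<open>A\<close> is
  \<open>n\<^sup>-\<^sup>E \<zeta>\<close> with \<open>\<zeta>\<close> in twice the ball \<open>B\<close>, and \<open>n P(n\<^sup>-\<^sup>E \<zeta>) = P(\<zeta>)\<close> is small uniformly in \<open>n\<close>. Taking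
  \<open>B\<close> inside a sublevel set that lies in the region of validity of the expansion keeps
  \<open>n\<^sup>-\<^sup>E \<zeta>\<close> in this region for every \<open>n \<ge> 1\<close>, so that no small values of \<open>n\<close> have to be treated apart.
\<close>

lemma lower_bound_at_maximum:
  fixes \<phi> :: "int ^ 'd \<Rightarrow> complex"
  assumes \<phi>: "l1 \<phi>" and z: "norm (fourier \<phi> z) = 1" and ex: "has_pos_hom_expansion \<phi> z \<alpha> P"
  shows "\<exists>C>0. \<forall>n\<ge>1. C * real n powr (- mu_poly P) \<le> sup_norm (conv_power \<phi> n)"
proof -
  have P: "positive_homogeneous P"
    using ex by (simp add: has_pos_hom_expansion_def pos_hom_polynomial_def)
  then obtain E where E: "E \<in> Exp_set P" "mu_poly P = trace E" by (rule mu_poly_exponent)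
  interpret homogeneous_function "\<lambda>\<xi>. Re (P \<xi>)" E by (rule homogeneous_function_Re[OF P E(1)])
  have P_hom: "P (real_powm t E *v \<xi>) = complex_of_real t * P \<xi>" if "0 < t" for t \<xi>
    using E(1) that by (simp add: Exp_set_def)
  have P0: "P 0 = 0"
    using P_hom[of 2 0] by simp
  obtain \<delta> where \<delta>: "0 < \<delta>" "\<And>\<xi>. norm \<xi> < \<delta> \<Longrightarrow> \<exists>L. fourier \<phi> (\<xi> + z) = fourier \<phi> z * exp L \<and>
       norm (L - (\<i> * complex_of_real (\<alpha> \<bullet> \<xi>) - P \<xi>)) \<le> Re (P \<xi>) / 2"
    using expansion_exp_form[OF assms] by blast
  obtain m where m: "0 < m" "{\<xi>. Re (P \<xi>) < m} \<subseteq> ball 0 (min \<delta> 1)"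
    using sublevel_subset_ball[of "min \<delta> 1"] \<delta>(1) by auto
  obtain r where r: "0 < r" "\<And>\<xi>. norm \<xi> < 2 * r \<Longrightarrow> norm (P \<xi>) < min m (1 / 8)"
  proof -
    have "isCont P 0"
      using P by (simp add: positive_homogeneous_def continuous_on_eq_continuous_at)
    then have "(P \<longlongrightarrow> P 0) (nhds 0)"
      by (simp only: isCont_def tendsto_at_iff_tendsto_nhds)
    then have "((\<lambda>\<xi>. norm (P \<xi>)) \<longlongrightarrow> 0) (nhds 0)"
      using tendsto_norm_zero P0 by auto
    then have "eventually (\<lambda>\<xi>. norm (P \<xi>) < min m (1 / 8)) (nhds 0)"
      using m(1) by (intro order_tendstoD(2)) auto
    then obtain d where d: "0 < d" "\<And>\<xi>. norm \<xi> < d \<Longrightarrow> norm (P \<xi>) < min m (1 / 8)"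
      unfolding eventually_nhds_metric by auto
    show ?thesis using d by (intro that[of "d / 2"]) auto
  qed
  define v where "v = measure lborel (ball (0 :: real ^ 'd) r)"
  have v: "0 < v"
    using r(1) content_ball_pos unfolding v_def by blast
  define c where "c = (2 * pi) ^ CARD('d)"
  have c: "0 < c" by (simp add: c_def)
  have "v / (2 * c) * real n powr (- mu_poly P) \<le> sup_norm (conv_power \<phi> n)" if n: "n \<ge> 1" for n
  proof -
    define t where "t = 1 / real n"
    have t: "0 < t" "1 / t = real n" "t \<le> 1" using n by (auto simp: t_def)
    let ?T = "(*v) (real_powm t E)"
    let ?A = "?T ` ball 0 r"
    have in_ball: "norm (?T \<xi>) < min \<delta> 1" if "norm \<xi> < 2 * r" for \<xi>
    proof -
      have "Re (P (?T \<xi>)) = t * Re (P \<xi>)" by (rule homogeneous[OF t(1)])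
      also have "\<dots> \<le> 1 * Re (P \<xi>)"
        using t nonneg by (intro mult_right_mono) auto
      also have "\<dots> < m"
        using r(2)[OF that] complex_Re_le_cmod[of "P \<xi>"] by simp
      finally show ?thesis using m(2) by auto
    qed
    have A_eq: "?A = {\<xi>. norm (real_powm (1 / t) E *v \<xi>) < r}"
    proof (intro set_eqI iffI)
      fix \<xi> assume "\<xi> \<in> {\<xi>. norm (real_powm (1 / t) E *v \<xi>) < r}"
      then have "real_powm (1 / t) E *v \<xi> \<in> ball 0 r" by simp
      moreover have "\<xi> = ?T (real_powm (1 / t) E *v \<xi>)"
        by (rule real_powm_inverse(1)[OF t(1), symmetric])
      ultimately show "\<xi> \<in> ?A" by blast
    qed (auto simp: real_powm_inverse[OF t(1)])
    have A_borel: "?A \<in> sets borel"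
      unfolding A_eq
      by (intro borel_open open_Collect_less continuous_on_norm continuous_on_const
          linear_continuous_on matrix_vector_mul_bounded_linear)
    have A_meas: "measure lborel ?A = v * real n powr (- mu_poly P)"
    proof -
      have "measure lborel ?A = measure lebesgue ?A"
        using A_borel by simp
      also have "\<dots> = \<bar>det (real_powm t E)\<bar> * measure lebesgue (ball (0 :: real ^ 'd) r)"
        using lmeasurable_matrix_image[of "real_powm t E"] by simp
      also have "\<bar>det (real_powm t E)\<bar> = real n powr (- mu_poly P)"
        using n by (simp add: det_real_powm t_def powr_divide powr_minus E(2) divide_simps)
      finally show ?thesis by (simp add: v_def)
    qed
    \<comment> \<open>This phase cancels the drift term \<open>i n \<alpha> \<bullet> \<xi>\<close> in the exponent.\<close>
    define w where "w \<eta> = exp (- (\<i> * complex_of_real (real n * (\<alpha> \<bullet> \<eta>))))" for \<eta> :: "real ^ 'd"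
    have "measure lborel ?A \<le> 2 * (2 * pi) ^ CARD('d) * sup_norm (conv_power \<phi> n)"
    proof (rule sup_norm_lower_bound)
      show "l1 (conv_power \<phi> n)" using \<phi> n by (rule abs_summable_conv_power)
      show "?A \<in> sets borel" by (rule A_borel)
      show "?A \<subseteq> cube"
      proof
        fix \<eta> assume "\<eta> \<in> ?A"
        then have "norm \<eta> < 1" using in_ball r(1) by force
        then have "\<bar>\<eta> $ i\<bar> \<le> pi" for i
          using component_le_norm_cart[of \<eta> i] pi_ge_two by linarith
        then show "\<eta> \<in> cube" by (simp add: mem_cube abs_le_iff) (metis minus_le_iff)
      qed
      show "continuous_on UNIV w" unfolding w_def by (intro continuous_intros)
      show "norm (w \<eta>) = 1" for \<eta> by (simp add: w_def)
      show "norm (cnj (fourier \<phi> z ^ n)) = 1" by (simp add: norm_power z)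
      fix \<eta> \<eta>' assume "\<eta> \<in> ?A" "\<eta>' \<in> ?A"
      then obtain x y where xy: "\<eta> = ?T x" "\<eta>' = ?T y" "norm x < r" "norm y < r" by auto
      define \<zeta> where "\<zeta> = x - y"
      have diff: "\<eta> - \<eta>' = ?T \<zeta>" by (simp add: xy \<zeta>_def matrix_vector_mult_diff_distrib)
      have \<zeta>: "norm \<zeta> < 2 * r"
        using norm_triangle_ineq4[of x y] xy by (simp add: \<zeta>_def)
      obtain L where L: "fourier \<phi> (?T \<zeta> + z) = fourier \<phi> z * exp L"
        "norm (L - (\<i> * complex_of_real (\<alpha> \<bullet> ?T \<zeta>) - P (?T \<zeta>))) \<le> Re (P (?T \<zeta>)) / 2"
        using \<delta>(2)[of "?T \<zeta>"] in_ball[OF \<zeta>] by auto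
      define q where "q = of_nat n * (L - \<i> * complex_of_real (\<alpha> \<bullet> ?T \<zeta>))"
      have "norm q \<le> 1 / 4"
      proof -
        have "norm (L - \<i> * complex_of_real (\<alpha> \<bullet> ?T \<zeta>)) \<le> Re (P (?T \<zeta>)) / 2 + norm (P (?T \<zeta>))"
          using norm_triangle_ineq4[of "L - (\<i> * complex_of_real (\<alpha> \<bullet> ?T \<zeta>) - P (?T \<zeta>))" "P (?T \<zeta>)"] L(2)
          by simp
        also have "\<dots> \<le> 2 * norm (P (?T \<zeta>))"
          using complex_Re_le_cmod[of "P (?T \<zeta>)"] norm_ge_zero[of "P (?T \<zeta>)"] by linarith
        also have "\<dots> = 2 * norm (P \<zeta>) / real n"
          unfolding P_hom[OF t(1)] using n by (simp add: norm_mult norm_divide t_def)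
        finally have "real n * norm (L - \<i> * complex_of_real (\<alpha> \<bullet> ?T \<zeta>)) \<le> 2 * norm (P \<zeta>)"
          using n by (simp add: pos_le_divide_eq mult.commute)
        then have "norm q \<le> 2 * norm (P \<zeta>)"
          by (simp only: q_def norm_mult norm_of_nat)
        then show ?thesis using r(2)[OF \<zeta>] by simp
      qed
      then have "1 / 2 \<le> Re (exp q)" by (rule Re_exp_ge_half)
      also have "exp q = cnj (fourier \<phi> z ^ n) * w \<eta> * cnj (w \<eta>') * fourier (conv_power \<phi> n) (z + \<eta> - \<eta>')"
      proof -
        have "fourier (conv_power \<phi> n) (z + \<eta> - \<eta>') = fourier \<phi> z ^ n * exp (of_nat n * L)"
        proof -
          have "z + \<eta> - \<eta>' = ?T \<zeta> + z" by (simp add: diff[symmetric])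
          then have "fourier \<phi> (z + \<eta> - \<eta>') = fourier \<phi> z * exp L"
            using L(1) by (simp only:)
          then show ?thesis
            by (simp add: fourier_conv_power[OF \<phi> n] power_mult_distrib exp_of_nat_mult)
        qed
        moreover have "cnj (fourier \<phi> z ^ n) * fourier \<phi> z ^ n = 1"
          using complex_norm_square[of "fourier \<phi> z ^ n"] z by (simp add: norm_power mult.commute)
        moreover have "w \<eta> * cnj (w \<eta>') * exp (of_nat n * L) = exp q"
        proof -
          have "w \<eta> * cnj (w \<eta>') = exp (- (\<i> * complex_of_real (real n * (\<alpha> \<bullet> (\<eta> - \<eta>')))))"
            by (simp add: w_def exp_cnj exp_add[symmetric] inner_diff_right algebra_simps)
          then show ?thesis
            by (simp add: q_def diff exp_add[symmetric] algebra_simps)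
        qed
        ultimately show ?thesis by (metis (no_types, lifting) mult.assoc mult.commute mult.left_neutral)
      qed
      finally show "1 / 2 \<le> Re (cnj (fourier \<phi> z ^ n) * w \<eta> * cnj (w \<eta>') * fourier (conv_power \<phi> n) (z + \<eta> - \<eta>'))" .
    qed
    then have "v * real n powr (- mu_poly P) \<le> 2 * c * sup_norm (conv_power \<phi> n)"
      by (simp only: A_meas c_def)
    then show ?thesis
      using c by (simp add: field_simps)
  qed
  then show ?thesis using v c by (intro exI[of _ "v / (2 * c)"]) auto
qed

section \<open>Passing from the maxima to the sup norm\<close>

lemma torus_representative:
  fixes \<xi> :: "real ^ 'd"
  obtains \<xi>' v where "\<xi>' \<in> torus" "\<xi> = \<xi>' + v" "\<And>i. \<exists>k::int. v $ i = 2 * pi * k"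
proof -
  define k where "k i = \<lceil>(\<xi> $ i - pi) / (2 * pi)\<rceil>" for i
  define v :: "real ^ 'd" where "v = (\<chi> i. 2 * pi * real_of_int (k i))"
  have "- pi < (\<xi> - v) $ i \<and> (\<xi> - v) $ i \<le> pi" for i
  proof -
    have "(\<xi> $ i - pi) / (2 * pi) \<le> k i" "k i < (\<xi> $ i - pi) / (2 * pi) + 1"
      unfolding k_def by linarith+
    then show ?thesis by (simp add: v_def field_simps)
  qed
  then have "\<xi> - v \<in> torus" by (simp add: torus_def)
  then show ?thesis by (rule that[of _ v]) (auto simp: v_def)
qed

lemma torus_subset_cube: "torus \<subseteq> cube"
  by (auto simp: torus_def mem_cube less_imp_le)

text \<open>
  The maxima in the closed cube need not lie in the half-open torus; through periodicity they inherit
  the expansion of the representative that does.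
\<close>

lemma has_pos_hom_expansion_periodic:
  assumes "\<And>i. \<exists>k::int. v $ i = 2 * pi * k"
  shows "has_pos_hom_expansion \<phi> (z + v) = has_pos_hom_expansion \<phi> z"
proof -
  have "fourier \<phi> (\<xi> + (z + v)) = fourier \<phi> (\<xi> + z)" for \<xi>
    using fourier_periodic[OF assms, of \<phi> "\<xi> + z"] by (simp add: add.assoc)
  then have "log_ratio \<phi> (z + v) = log_ratio \<phi> z"
    using fourier_periodic[OF assms, of \<phi> z] by (simp add: log_ratio_def fun_eq_iff)
  then show ?thesis by (simp add: has_pos_hom_expansion_def fun_eq_iff)
qed

lemma norm_conv_power_le:
  fixes \<phi> :: "int ^ 'd \<Rightarrow> complex"
  assumes \<phi>: "l1 \<phi>" and n: "1 \<le> n"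
  shows "ennreal (norm (conv_power \<phi> n x))
    \<le> (\<integral>\<^sup>+\<xi>. ennreal (norm (fourier \<phi> \<xi>) ^ n) * indicator cube \<xi> \<partial>lborel)"
proof -
  let ?c = "(2 * pi) ^ CARD('d)"
  let ?\<psi> = "conv_power \<phi> n"
  \<comment> \<open>The factor \<open>(2 \<pi>)\<^sup>d \<ge> 1\<close> from the inversion formula is simply dropped.\<close>
  have "1 \<le> ?c" using pi_ge_two by (intro one_le_power) simp
  then have "norm (?\<psi> x) \<le> ?c * norm (?\<psi> x)"
    using mult_right_mono[of 1 ?c "norm (?\<psi> x)"] by simp
  also have "\<dots> = norm (complex_of_real ?c * ?\<psi> x)" by (simp add: norm_mult norm_power)
  also have "\<dots> = norm (\<integral>\<xi>. fourier ?\<psi> \<xi> * cnj (lattice_char x \<xi>) \<partial>cube_measure)"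
    by (simp only: fourier_inversion[OF abs_summable_conv_power[OF \<phi> n]])
  finally have "ennreal (norm (?\<psi> x)) \<le> ennreal (norm (\<integral>\<xi>. fourier ?\<psi> \<xi> * cnj (lattice_char x \<xi>) \<partial>cube_measure))"
    by (rule ennreal_leI)
  also have "\<dots> \<le> (\<integral>\<^sup>+\<xi>. ennreal (norm (fourier ?\<psi> \<xi> * cnj (lattice_char x \<xi>))) \<partial>cube_measure)"
    by (cases "integrable cube_measure (\<lambda>\<xi>. fourier ?\<psi> \<xi> * cnj (lattice_char x \<xi>))")
       (auto intro: integral_norm_bound_ennreal simp: not_integrable_integral_eq simp del: norm_mult)
  also have "\<dots> = (\<integral>\<^sup>+\<xi>. ennreal (norm (fourier \<phi> \<xi>) ^ n) * indicator cube \<xi> \<partial>lborel)"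
    unfolding cube_measure_def
    by (subst nn_integral_restrict_space) (simp_all add: norm_mult fourier_conv_power[OF \<phi> n] norm_power)
  finally show ?thesis .
qed

theorem theorem1p4:
  fixes \<phi> :: "int ^ 'd \<Rightarrow> complex"
  assumes "\<phi> \<in> S_space"
    and "(SUP \<xi>. norm (fourier \<phi> \<xi>)) = 1"
    and "\<forall>\<xi> \<in> Omega \<phi>. pos_hom_type \<phi> \<xi>"
  shows "\<exists>C > 0. \<exists>C' > 0. \<forall>n \<ge> 1.
           C' * real n powr (- mu \<phi>) \<le> sup_norm (conv_power \<phi> n) \<and>
           sup_norm (conv_power \<phi> n) \<le> C * real n powr (- mu \<phi>)"
proof -
  have \<phi>: "l1 \<phi>" by (rule S_space_abs_summable[OF assms(1)])
  have cont: "continuous_on UNIV (fourier \<phi>)" by (rule continuous_on_fourier[OF \<phi>])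
  have bdd: "bdd_above (range (\<lambda>\<xi>. norm (fourier \<phi> \<xi>)))"
    by (rule bdd_aboveI2) (rule norm_fourier_le[OF \<phi>])
  have le1: "norm (fourier \<phi> \<xi>) \<le> 1" for \<xi>
    using cSUP_upper[OF UNIV_I bdd, of \<xi>] assms(2) by simp

  have expansion: "\<exists>\<alpha>. has_pos_hom_expansion \<phi> \<xi> \<alpha> (pos_hom_part \<phi> \<xi>)" if "\<xi> \<in> Omega \<phi>" for \<xi>
  proof -
    have "\<exists>P \<alpha>. has_pos_hom_expansion \<phi> \<xi> \<alpha> P"
      using assms(3) that unfolding pos_hom_type_def by blast
    then show ?thesis unfolding pos_hom_part_def by (rule someI_ex)
  qed
  have maximum: "\<exists>\<xi>'\<in>Omega \<phi>. \<exists>\<alpha>. has_pos_hom_expansion \<phi> \<xi> \<alpha> (pos_hom_part \<phi> \<xi>')"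
    if "norm (fourier \<phi> \<xi>) = 1" for \<xi>
  proof -
    obtain \<xi>' v where v: "\<xi>' \<in> torus" "\<xi> = \<xi>' + v" "\<And>i. \<exists>k::int. v $ i = 2 * pi * k"
      by (rule torus_representative[of \<xi>]) blast
    have "\<xi>' \<in> Omega \<phi>"
      using v(1) that fourier_periodic[OF v(3), of \<phi> \<xi>'] by (simp add: Omega_def v(2))
    then show ?thesis
      using expansion[of \<xi>'] has_pos_hom_expansion_periodic[OF v(3), of \<phi> \<xi>'] v(2) by auto
  qed

  have "Omega \<phi> \<noteq> {}"
  proof -
    have "(0 :: real ^ 'd) \<in> cube" by (simp add: mem_cube)
    then have "cube \<noteq> ({} :: (real ^ 'd) set)" by blast
    then obtain \<xi> where \<xi>: "\<And>\<eta>. \<eta> \<in> cube \<Longrightarrow> norm (fourier \<phi> \<eta>) \<le> norm (fourier \<phi> \<xi>)"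
      using continuous_attains_sup[OF compact_cube, of "\<lambda>\<xi>. norm (fourier \<phi> \<xi>)"]
        continuous_on_norm[OF continuous_on_subset[OF cont]] by (metis subset_UNIV)
    have "norm (fourier \<phi> \<eta>) \<le> norm (fourier \<phi> \<xi>)" for \<eta>
    proof -
      obtain \<eta>' v where v: "\<eta>' \<in> torus" "\<eta> = \<eta>' + v" "\<And>i. \<exists>k::int. v $ i = 2 * pi * k"
        by (rule torus_representative[of \<eta>]) blast
      then show ?thesis
        using \<xi>[of \<eta>'] torus_subset_cube fourier_periodic[OF v(3), of \<phi> \<eta>'] by auto
    qed
    then have "1 \<le> norm (fourier \<phi> \<xi>)"
      unfolding assms(2)[symmetric] by (intro cSUP_least) auto
    then show ?thesis using maximum[of \<xi>] le1[of \<xi>] by auto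
  qed
  moreover have "finite (Omega \<phi>)"
  proof -
    \<comment> \<open>Each point has a neighbourhood that contains no maximum except possibly the point itself; the
      compact cube is covered by finitely many of these.\<close>
    have "\<exists>U. open U \<and> z \<in> U \<and> (\<forall>\<xi>\<in>U. norm (fourier \<phi> \<xi>) = 1 \<longrightarrow> \<xi> = z)" for z
    proof (cases "norm (fourier \<phi> z) = 1")
      case True
      then obtain \<alpha> P where "has_pos_hom_expansion \<phi> z \<alpha> P" using maximum by blast
      from maximum_isolated[OF \<phi> True this] obtain \<delta>
        where "0 < \<delta>" "\<And>\<xi>. \<xi> \<in> ball z \<delta> \<Longrightarrow> norm (fourier \<phi> \<xi>) = 1 \<Longrightarrow> \<xi> = z" by blast
      then show ?thesis by (intro exI[of _ "ball z \<delta>"]) auto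
    next
      case False
      have "open {\<xi>. norm (fourier \<phi> \<xi>) < 1}"
        by (intro open_Collect_less continuous_on_norm cont continuous_on_const)
      then show ?thesis
        using False le1[of z] by (intro exI[of _ "{\<xi>. norm (fourier \<phi> \<xi>) < 1}"]) auto
    qed
    then obtain U where U: "\<And>z. open (U z)" "\<And>z. z \<in> U z"
      "\<And>z \<xi>. \<xi> \<in> U z \<Longrightarrow> norm (fourier \<phi> \<xi>) = 1 \<Longrightarrow> \<xi> = z"
      by metis
    obtain T where T: "T \<subseteq> cube" "finite T" "cube \<subseteq> (\<Union>z\<in>T. U z)"
      by (rule compactE_image[OF compact_cube, of cube U]) (use U(1,2) in blast)+
    have "Omega \<phi> \<subseteq> T"
    proof
      fix \<xi> assume \<xi>: "\<xi> \<in> Omega \<phi>"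
      then obtain z where "z \<in> T" "\<xi> \<in> U z"
        using T(3) torus_subset_cube by (auto simp: Omega_def)
      with U(3) \<xi> show "\<xi> \<in> T" by (auto simp: Omega_def)
    qed
    then show ?thesis using T(2) finite_subset by blast
  qed
  ultimately have mu_in: "mu \<phi> \<in> (\<lambda>\<xi>. mu_poly (pos_hom_part \<phi> \<xi>)) ` Omega \<phi>"
    and mu_le: "\<And>\<xi>. \<xi> \<in> Omega \<phi> \<Longrightarrow> mu \<phi> \<le> mu_poly (pos_hom_part \<phi> \<xi>)"
    unfolding mu_def by (auto intro!: Min_in)

  obtain C' where C': "C' > 0" "\<And>n. n \<ge> 1 \<Longrightarrow> C' * real n powr (- mu \<phi>) \<le> sup_norm (conv_power \<phi> n)"
  proof -
    obtain \<xi> where \<xi>: "\<xi> \<in> Omega \<phi>" "mu \<phi> = mu_poly (pos_hom_part \<phi> \<xi>)"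
      using mu_in by blast
    obtain \<alpha> where \<alpha>: "has_pos_hom_expansion \<phi> \<xi> \<alpha> (pos_hom_part \<phi> \<xi>)"
      using expansion[OF \<xi>(1)] by blast
    have "norm (fourier \<phi> \<xi>) = 1" using \<xi>(1) by (simp add: Omega_def)
    from lower_bound_at_maximum[OF \<phi> this \<alpha>] show ?thesis
      using that by (auto simp: \<xi>(2))
  qed

  obtain C where C: "C > 0" "\<And>n. n \<ge> 1 \<Longrightarrow>
      (\<integral>\<^sup>+\<xi>. ennreal (norm (fourier \<phi> \<xi>) ^ n) * indicator cube \<xi> \<partial>lborel) \<le> ennreal (C * real n powr (- mu \<phi>))"
  proof -
    have "\<exists>C>0. \<forall>n\<ge>1.
      (\<integral>\<^sup>+\<xi>. ennreal (norm (fourier \<phi> \<xi>) ^ n) * indicator cube \<xi> \<partial>lborel) \<le> ennreal (C * real n powr (- mu \<phi>))"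
    proof (rule nn_integral_power_le[OF compact_cube cont le1])
      fix z assume z: "norm (fourier \<phi> z) = 1"
      then obtain \<xi> \<alpha> where \<xi>: "\<xi> \<in> Omega \<phi>" "has_pos_hom_expansion \<phi> z \<alpha> (pos_hom_part \<phi> \<xi>)"
        using maximum by blast
      obtain U C where UC: "open U" "z \<in> U" "0 < C" "\<And>n. n \<ge> 1 \<Longrightarrow>
          (\<integral>\<^sup>+\<xi>. ennreal (norm (fourier \<phi> \<xi>) ^ n) * indicator U \<xi> \<partial>lborel)
            \<le> ennreal (C * real n powr (- mu_poly (pos_hom_part \<phi> \<xi>)))"
        using local_upper_bound[OF \<phi> z \<xi>(2)] by blast
      have "ennreal (C * real n powr (- mu_poly (pos_hom_part \<phi> \<xi>))) \<le> ennreal (C * real n powr (- mu \<phi>))"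
        if "n \<ge> 1" for n
        using that mu_le[OF \<xi>(1)] UC(3) by (intro ennreal_leI mult_left_mono powr_mono) auto
      then show "\<exists>U C. open U \<and> z \<in> U \<and> 0 < C \<and> (\<forall>n\<ge>1.
          (\<integral>\<^sup>+\<xi>. ennreal (norm (fourier \<phi> \<xi>) ^ n) * indicator U \<xi> \<partial>lborel) \<le> ennreal (C * real n powr (- mu \<phi>)))"
        using UC order_trans by (intro exI[of _ U] exI[of _ C]) blast
    qed
    then show ?thesis using that by blast
  qed
  have "sup_norm (conv_power \<phi> n) \<le> C * real n powr (- mu \<phi>)" if n: "n \<ge> 1" for n
    unfolding sup_norm_def
  proof (rule cSUP_least)
    fix x
    have "ennreal (norm (conv_power \<phi> n x)) \<le> ennreal (C * real n powr (- mu \<phi>))"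
      using norm_conv_power_le[OF \<phi> n, of x] C(2)[OF n] by (rule order_trans)
    then show "norm (conv_power \<phi> n x) \<le> C * real n powr (- mu \<phi>)"
      using C(1) by (simp add: ennreal_le_iff)
  qed simp
  with C(1) C' show ?thesis by blast
qed

end
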